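(* Let $A\in\mathbb{R}^{m\times m}$ be Hurwitz stable, $B,q\in\mathbb{R}^{m}$ columns, $C\in\mathbb{R}^{1\times m}$ a row, $\psi\in\mathbb{R}$, and let $T,\sigma_1,\sigma_*>0$. Consider the closed-loop pulse-width modulated system $$\frac{dx}{dt}=Ax+Bf+q,\qquad \sigma=Cx+\psi,\qquad f=M\sigma ,$$ where $M$ is the pulse-width modulator with period $T$ and ramp parameters $\sigma_1,\sigma_*$ (defined in the context). Assume that there exists an unsaturated $T$-periodic solution $x^0(t)$, $\sigma^0(t)$ of this system, with pulse duration $\tau^0$, and that the estimate $$\left|\frac{d\sigma^0(t)}{dt}\right|\le L_1$$ is valid, where $L_1$ is a positive constant. Put $\kappa=-CB$, $\kappa_1=-CAB$, $\kappa_2=T/\pi$. For a symmetric $m\times m$ matrix $H$ and scalars $\varepsilon,\nu$ define the symmetric $(m+3)\times(m+3)$ matrices $$L(H)=\begin{bmatrix} HA+A^\top H & HAB & HB & 0\\ B^\top A^\top H & 0&0&0\\ B^\top H&0&0&0\\ 0&0&0&0\end{bmatrix},$$ $$R(\varepsilon,\nu)=\begin{bmatrix} 0&0&-\tfrac12 C^\top & \kappa_2A^\top C^\top\\ 0& 3\nu/T^2 & 0 & -\kappa_2\kappa_1\\ -\tfrac12 C & 0 & \sigma_*-TL_1-\nu-\varepsilon-T|\kappa| & -\kappa_2\kappa\\ \kappa_2CA & -\kappa_2\kappa_1 & -\kappa_2\kappa & \varepsilon\end{bmatrix}.$$ Suppose there exist a symmetric $m\times m$ matrix $H$ and scalars $\varepsilon,\nu$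 such that $$L(H)\prec R(\varepsilon,\nu),\qquad H\succ0,\qquad \nu>0,\qquad \varepsilon>0 .$$ Then for any solution $x(t)$ of the system, with pulse durations $\tau_n$ ($n=0,1,\dots$), $$\lim_{t\to+\infty}[x(t)-x^0(t)]=0,\qquad \lim_{n\to\infty}\tau_n=\tau^0 .$$ Moreover, the solution $x^0(t)$ is stable in the sense of Lyapunov.
   Context: A square matrix is Hurwitz stable if all its eigenvalues have negative real parts. $\prec$, $\succ$ denote negative and positive definiteness for symmetric matrices ($X\prec Y$ means $X-Y\prec 0$); $\top$ denotes transpose. Pulse-width modulator $M$ with period $T>0$ and ramp parameters $\sigma_1,\sigma_*>0$: for an input signal $\sigma(t)$, $t\ge0$, the output $f=M\sigma$ is $$f(t)=\begin{cases}1,& nT\le t<nT+\tau_n,\\ 0,& nT+\tau_n\le t<(n+1)T,\end{cases}\qquad n=0,1,\dots,$$ where the pulse durations $\tau_n\in[0,T]$ are determined as follows. If $\sigma(nT)\le\sigma_1$, then $\tau_n=0$. If $\sigma(nT+\tau)>\sigma_1+\sigma_*\tau/T$ for all $0\le\tau\le T$, then $\tau_n=T$. In all other cases $\tau_n$ is the smallest $\tau\in[0,T]$ satisfying $\sigma(nT+\tau)=\sigma_1+\sigma_*\tau/T$. Solutions are considered on $t\ge0$, with $x(t)$ continuous and the differential equation holding except at the switching instants of $f$; the bound on $d\sigma^0/dt$ is understood wherever this derivative exists (i.e. off switching instants). A $T$-periodic solution has all its pulse durations $\tau_n$ equal to a common value, called its pulse duration. It is called unsaturated if neither $f(t)\equiv0$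 nor $f(t)\equiv1$. *)

theory Defs
  imports "HOL-Analysis.Analysis"
begin

definition hurwitz_stable :: "real ^ 'm ^ 'm \<Rightarrow> bool" where
  "hurwitz_stable A \<longleftrightarrow>
     (\<forall>(\<mu>::complex) (v::complex ^ 'm).
        v \<noteq> 0 \<and> map_matrix complex_of_real A *v v = \<mu> *s v \<longrightarrow> Re \<mu> < 0)"

definition symmetric_matrix :: "real ^ 'n ^ 'n \<Rightarrow> bool" where
  "symmetric_matrix X \<longleftrightarrow> transpose X = X"

definition positive_definite :: "real ^ 'n ^ 'n \<Rightarrow> bool" where
  "positive_definite X \<longleftrightarrow> symmetric_matrix X \<and> (\<forall>v. v \<noteq> 0 \<longrightarrow> v \<bullet> (X *v v) > 0)"

definition negative_definite :: "real ^ 'n ^ 'n \<Rightarrow> bool" where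
  "negative_definite X \<longleftrightarrow> symmetric_matrix X \<and> (\<forall>v. v \<noteq> 0 \<longrightarrow> v \<bullet> (X *v v) < 0)"

definition definite_less :: "real ^ 'n ^ 'n \<Rightarrow> real ^ 'n ^ 'n \<Rightarrow> bool"  (infix "\<prec>" 50) where
  "X \<prec> Y \<longleftrightarrow> negative_definite (X - Y)"


text \<open>
  In the last case of the modulation law the least \<open>\<tau>\<close> exists whenever the input is
  continuous on \<open>[n T, (n + 1) T]\<close>, which is so for every solution of the closed loop.
\<close>

definition pulse_duration :: "real \<Rightarrow> real \<Rightarrow> real \<Rightarrow> (real \<Rightarrow> real) \<Rightarrow> nat \<Rightarrow> real" where
  "pulse_duration T \<sigma>1 \<sigma>s \<sigma> n =
     (if \<sigma> (real n * T) \<le> \<sigma>1 then 0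
      else if \<forall>\<tau>\<in>{0..T}. \<sigma> (real n * T + \<tau>) > \<sigma>1 + \<sigma>s * \<tau> / T then T
      else (LEAST \<tau>. \<tau> \<in> {0..T} \<and> \<sigma> (real n * T + \<tau>) = \<sigma>1 + \<sigma>s * \<tau> / T))"

definition modulator :: "real \<Rightarrow> real \<Rightarrow> real \<Rightarrow> (real \<Rightarrow> real) \<Rightarrow> real \<Rightarrow> real" where
  "modulator T \<sigma>1 \<sigma>s \<sigma> t =
     (if \<exists>n. real n * T \<le> t \<and> t < real n * T + pulse_duration T \<sigma>1 \<sigma>s \<sigma> n then 1 else 0)"

text \<open>
  Trajectories are total functions of which only the restriction to \<open>t \<ge> 0\<close> matters;
  derivatives and continuity are therefore relative to \<open>{0..}\<close>.  The row \<open>C\<close> is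
  represented by the vector with the same entries, so that the scalar \<open>C x\<close> is \<open>C \<bullet> x\<close>.
\<close>

definition switching_instant :: "(real \<Rightarrow> real) \<Rightarrow> real \<Rightarrow> bool" where
  "switching_instant f t \<longleftrightarrow> t \<ge> 0 \<and> \<not> continuous (at t within {0..}) f"

definition system_output :: "real ^ 'm \<Rightarrow> real \<Rightarrow> (real \<Rightarrow> real ^ 'm) \<Rightarrow> real \<Rightarrow> real" where
  "system_output C \<psi> x t = C \<bullet> x t + \<psi>"

definition pwm_solution ::
  "real ^ 'm ^ 'm \<Rightarrow> real ^ 'm \<Rightarrow> real ^ 'm \<Rightarrow> real ^ 'm \<Rightarrow> real \<Rightarrow> real \<Rightarrow> real \<Rightarrow> real \<Rightarrow>
   (real \<Rightarrow> real ^ 'm) \<Rightarrow> bool" where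
  "pwm_solution A B q C \<psi> T \<sigma>1 \<sigma>s x \<longleftrightarrow>
     (let f = modulator T \<sigma>1 \<sigma>s (system_output C \<psi> x) in
        continuous_on {0..} x \<and>
        (\<forall>t\<ge>0. \<not> switching_instant f t \<longrightarrow>
           (x has_vector_derivative (A *v x t + f t *\<^sub>R B + q)) (at t within {0..})))"

definition periodic_on_nonneg :: "real \<Rightarrow> (real \<Rightarrow> 'a) \<Rightarrow> bool" where
  "periodic_on_nonneg T x \<longleftrightarrow> (\<forall>t\<ge>0. x (t + T) = x t)"

definition unsaturated :: "(real \<Rightarrow> real) \<Rightarrow> bool" where
  "unsaturated f \<longleftrightarrow> \<not> (\<forall>t\<ge>0. f t = 0) \<and> \<not> (\<forall>t\<ge>0. f t = 1)"

text \<open>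
  Stability of \<open>x0\<close> among the trajectories satisfying \<open>Sol\<close>, with initial instant 0.
\<close>

definition lyapunov_stable ::
  "((real \<Rightarrow> 'a::real_normed_vector) \<Rightarrow> bool) \<Rightarrow> (real \<Rightarrow> 'a) \<Rightarrow> bool" where
  "lyapunov_stable Sol x0 \<longleftrightarrow>
     (\<forall>e>0. \<exists>d>0. \<forall>x. Sol x \<and> norm (x 0 - x0 0) < d \<longrightarrow>
        (\<forall>t\<ge>0. norm (x t - x0 t) < e))"


text \<open>
  \<open>block P U V D\<close> is the matrix with leading block \<open>P\<close>, trailing block \<open>D\<close>, upper right
  block with columns \<open>U $ 1, U $ 2, U $ 3\<close> and lower left block with rows
  \<open>V $ 1, V $ 2, V $ 3\<close>.
\<close>

definition block ::
  "real ^ 'm ^ 'm \<Rightarrow> real ^ 'm ^ 3 \<Rightarrow> real ^ 'm ^ 3 \<Rightarrow> real ^ 3 ^ 3 \<Rightarrow> real ^ ('m + 3) ^ ('m + 3)"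
  where
  "block P U V D =
     (\<chi> i j. case i of
        Inl a \<Rightarrow> (case j of Inl b \<Rightarrow> P $ a $ b | Inr l \<Rightarrow> U $ l $ a)
      | Inr k \<Rightarrow> (case j of Inl b \<Rightarrow> V $ k $ b | Inr l \<Rightarrow> D $ k $ l))"

definition L_matrix ::
  "real ^ 'm ^ 'm \<Rightarrow> real ^ 'm \<Rightarrow> real ^ 'm ^ 'm \<Rightarrow> real ^ ('m + 3) ^ ('m + 3)" where
  "L_matrix A B H =
     block (H ** A + transpose A ** H)
           (vector [H *v (A *v B), H *v B, 0])
           (vector [(B v* transpose A) v* H, B v* H, 0])
           0"

definition R_matrix ::
  "real ^ 'm ^ 'm \<Rightarrow> real ^ 'm \<Rightarrow> real ^ 'm \<Rightarrow> real \<Rightarrow> real \<Rightarrow> real \<Rightarrow> real \<Rightarrow> real \<Rightarrow>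
   real ^ ('m + 3) ^ ('m + 3)" where
  "R_matrix A B C T \<sigma>s L1 \<epsilon> \<nu> =
     (let \<kappa> = - (C \<bullet> B); \<kappa>1 = - (C \<bullet> (A *v B)); \<kappa>2 = T / pi in
      block 0
            (vector [0, - (1/2) *\<^sub>R C, \<kappa>2 *\<^sub>R (transpose A *v C)])
            (vector [0, - (1/2) *\<^sub>R C, \<kappa>2 *\<^sub>R (C v* A)])
            (vector [vector [3 * \<nu> / T\<^sup>2, 0, - \<kappa>2 * \<kappa>1],
                     vector [0, \<sigma>s - T * L1 - \<nu> - \<epsilon> - T * \<bar>\<kappa>\<bar>, - \<kappa>2 * \<kappa>],
                     vector [- \<kappa>2 * \<kappa>1, - \<kappa>2 * \<kappa>, \<epsilon>]]))"

end

theory Submission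
  imports Defs
begin

text \<open>
  Let \<open>\<xi> = x - x0\<close> be the deviation of a solution from the periodic one.  It is driven by the
  difference of two pulses, which over the \<open>n\<close>-th period has mean \<open>v = (\<tau>\<^sub>n - \<tau>\<^sup>0) / T\<close>.  Following the
  averaging method, the rest of the input is integrated to a function \<open>u\<close> that vanishes at the
  sampling instants, and \<open>y = \<xi> - u B\<close> satisfies \<open>y' = A y + u A B + v B\<close>.  The Lyapunov function is
  \<open>V = y \<bullet> (H *v y)\<close>, and the matrix inequality bounds its derivative by a quadratic form in
  \<open>(y, u, v)\<close> and a free scalar (\<open>dissipation_of_lmi\<close>).

  That form may be positive at single instants, but its integral over a period is not
  (\<open>period_energy_balance\<close>).  Three facts achieve this.  The function \<open>u\<close> is a zigzag whose squared
  integral is at most \<open>T\<^sup>3 v\<^sup>2 / 3\<close> (\<open>integral_pulse_discrepancy_square\<close>).  At the instant at which the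
  pulse of \<open>x\<close> ends, the ramp and the bound \<open>L1\<close> give \<open>v (C \<bullet> \<xi>) \<ge> (\<sigma>s - T L1) v\<^sup>2\<close>
  (\<open>mismatch_period_of_solutions\<close>).  At all other instants, \<open>C \<bullet> y\<close> differs from its value there by an
  amount that Wirtinger's inequality for a function with a zero bounds in the mean by the derivative of
  \<open>C \<bullet> y\<close> (\<open>wirtinger_zero_in_interval\<close>); hence the constants \<open>2 T / \<pi>\<close> and \<open>\<kappa>\<^sub>2 = T / \<pi>\<close>.

  Therefore \<open>V\<close> does not increase from one sampling instant to the next, and its loss over a period
  dominates \<open>(norm (\<xi> t))\<^sup>2\<close> throughout the period as well as \<open>(\<tau>\<^sub>n - \<tau>\<^sup>0)\<^sup>2\<close>, uniformly
  (\<open>period_estimate\<close>).  Since \<open>V \<ge> 0\<close>, the losses tend to 0, which gives both limits; and every loss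
  is at most the initial value of \<open>V\<close>, which gives Lyapunov stability.
\<close>

section \<open>Wirtinger's inequality for a function with a zero\<close>

text \<open>
  A solution \<open>\<phi>\<close> of the Riccati equation \<open>\<phi>' = - \<omega>\<^sup>2 - \<phi>\<^sup>2\<close> completes the square:
  \<open>f'\<^sup>2 - \<omega>\<^sup>2 f\<^sup>2 = (f' - f \<phi>)\<^sup>2 + (f\<^sup>2 \<phi>)'\<close>.
\<close>

lemma riccati_integral_bound:
  fixes f g \<phi> :: "real \<Rightarrow> real"
  assumes "a \<le> b" and "finite S"
    and f: "continuous_on {a..b} f" and g: "continuous_on {a..b} g"
    and \<phi>: "continuous_on {a..b} \<phi>"
    and df: "\<And>t. t \<in> {a<..<b} - S \<Longrightarrow> (f has_real_derivative g t) (at t)"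
    and d\<phi>: "\<And>t. t \<in> {a<..<b} - S \<Longrightarrow> (\<phi> has_real_derivative - \<omega>\<^sup>2 - (\<phi> t)\<^sup>2) (at t)"
  shows "(f b)\<^sup>2 * \<phi> b - (f a)\<^sup>2 * \<phi> a
           \<le> integral {a..b} (\<lambda>t. (g t)\<^sup>2) - \<omega>\<^sup>2 * integral {a..b} (\<lambda>t. (f t)\<^sup>2)"
proof -
  let ?h = "\<lambda>t. 2 * f t * g t * \<phi> t + (f t)\<^sup>2 * (- \<omega>\<^sup>2 - (\<phi> t)\<^sup>2)"
  have 1: "(?h has_integral (f b)\<^sup>2 * \<phi> b - (f a)\<^sup>2 * \<phi> a) {a..b}"
  proof (rule fundamental_theorem_of_calculus_interior_strong[OF assms(2,1)])
    fix t assume t: "t \<in> {a<..<b} - S"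
    show "((\<lambda>t. (f t)\<^sup>2 * \<phi> t) has_vector_derivative ?h t) (at t)"
      unfolding has_real_derivative_iff_has_vector_derivative[symmetric]
      by (auto intro!: derivative_eq_intros df[OF t] d\<phi>[OF t] simp: algebra_simps)
  qed (intro continuous_intros f \<phi>)
  have 2: "((\<lambda>t. (g t)\<^sup>2 - \<omega>\<^sup>2 * (f t)\<^sup>2) has_integral
      integral {a..b} (\<lambda>t. (g t)\<^sup>2) - \<omega>\<^sup>2 * integral {a..b} (\<lambda>t. (f t)\<^sup>2)) {a..b}"
    by (intro has_integral_diff has_integral_mult_right integrable_integral
        integrable_continuous_real continuous_intros f g)
  show ?thesis
  proof (rule has_integral_le[OF 1 2])
    fix t
    have "0 \<le> (g t - f t * \<phi> t)\<^sup>2" by simp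
    then show "?h t \<le> (g t)\<^sup>2 - \<omega>\<^sup>2 * (f t)\<^sup>2"
      by (simp add: power2_eq_square algebra_simps)
  qed
qed

text \<open>
  On an interval of length \<open>\<ell>\<close> with \<open>f = 0\<close> at one end the best constant is \<open>(2 \<ell> / \<pi>)\<^sup>2\<close>,
  attained by a quarter of a sine wave.  A zero \<open>c\<close> anywhere in \<open>[a, b]\<close> cuts it into two such
  intervals, each no longer than \<open>b - a\<close>.  On either side a multiple of the tangent that vanishes
  at the free end solves the Riccati equation, so both boundary terms vanish.  At the critical
  frequency this tangent could reach its pole, hence the estimate is proved for every smaller
  frequency and the limit is taken at the end.
\<close>

lemma wirtinger_zero_in_interval:
  fixes f g :: "real \<Rightarrow> real"
  assumes "a < b" and S: "finite S"
    and f: "continuous_on {a..b} f" and g: "continuous_on {a..b} g"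
    and df: "\<And>t. t \<in> {a<..<b} - S \<Longrightarrow> (f has_real_derivative g t) (at t)"
    and c: "c \<in> {a..b}" "f c = 0"
  shows "integral {a..b} (\<lambda>t. (f t)\<^sup>2) \<le> (2 * (b - a) / pi)\<^sup>2 * integral {a..b} (\<lambda>t. (g t)\<^sup>2)"
proof -
  define F where "F = integral {a..b} (\<lambda>t. (f t)\<^sup>2)"
  define G where "G = integral {a..b} (\<lambda>t. (g t)\<^sup>2)"
  define \<omega>0 where "\<omega>0 = pi / (2 * (b - a))"
  have \<omega>0: "\<omega>0 > 0" using \<open>a < b\<close> by (simp add: \<omega>0_def)
  have f2: "(\<lambda>t. (f t)\<^sup>2) integrable_on {a..b}" and g2: "(\<lambda>t. (g t)\<^sup>2) integrable_on {a..b}"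
    by (intro integrable_continuous_real continuous_intros f g)+
  have *: "\<omega>\<^sup>2 * F \<le> G" if \<omega>: "0 < \<omega>" "\<omega> < \<omega>0" for \<omega>
  proof -
    have small: "\<omega> * s < pi / 2" "- (pi / 2) < \<omega> * s" "cos (\<omega> * s) \<noteq> 0"
      if "0 \<le> s" "s \<le> b - a" for s
    proof -
      have "\<omega> * s \<le> \<omega> * (b - a)" using that \<omega> by simp
      also have "\<dots> < \<omega>0 * (b - a)" using \<omega> \<open>a < b\<close> by simp
      also have "\<dots> = pi / 2" using \<open>a < b\<close> by (simp add: \<omega>0_def divide_simps)
      finally show 1: "\<omega> * s < pi / 2" .
      have "0 \<le> \<omega> * s" using that \<omega> by simp
      then show 2: "- (pi / 2) < \<omega> * s" using pi_gt_zero by linarith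
      show "cos (\<omega> * s) \<noteq> 0" using cos_gt_zero_pi[OF 2 1] by simp
    qed
    have sq: "inverse (cos z) * inverse (cos z) = 1 + tan z * tan z" if "cos z \<noteq> 0" for z :: real
      using tan_sec[OF that] by (simp add: power2_eq_square)
    have left: "0 \<le> integral {a..c} (\<lambda>t. (g t)\<^sup>2) - \<omega>\<^sup>2 * integral {a..c} (\<lambda>t. (f t)\<^sup>2)"
    proof -
      define \<phi> where "\<phi> = (\<lambda>t. - (\<omega> * tan (\<omega> * (t - a))))"
      have "(f c)\<^sup>2 * \<phi> c - (f a)\<^sup>2 * \<phi> a
           \<le> integral {a..c} (\<lambda>t. (g t)\<^sup>2) - \<omega>\<^sup>2 * integral {a..c} (\<lambda>t. (f t)\<^sup>2)"
      proof (rule riccati_integral_bound[OF _ S])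
        show "continuous_on {a..c} \<phi>" unfolding \<phi>_def
          by (intro continuous_intros) (use small(3) c in auto)
        fix t assume t: "t \<in> {a<..<c} - S"
        show "(\<phi> has_real_derivative - \<omega>\<^sup>2 - (\<phi> t)\<^sup>2) (at t)"
          unfolding \<phi>_def using small(3)[of "t - a"] c t
          by (auto intro!: derivative_eq_intros simp: sq power2_eq_square algebra_simps)
      qed (use c df in \<open>auto intro: continuous_on_subset[OF f] continuous_on_subset[OF g]\<close>)
      then show ?thesis using c by (simp add: \<phi>_def)
    qed
    have right: "0 \<le> integral {c..b} (\<lambda>t. (g t)\<^sup>2) - \<omega>\<^sup>2 * integral {c..b} (\<lambda>t. (f t)\<^sup>2)"
    proof -
      define \<phi> where "\<phi> = (\<lambda>t. \<omega> * tan (\<omega> * (b - t)))"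
      have "(f b)\<^sup>2 * \<phi> b - (f c)\<^sup>2 * \<phi> c
           \<le> integral {c..b} (\<lambda>t. (g t)\<^sup>2) - \<omega>\<^sup>2 * integral {c..b} (\<lambda>t. (f t)\<^sup>2)"
      proof (rule riccati_integral_bound[OF _ S])
        show "continuous_on {c..b} \<phi>" unfolding \<phi>_def
          by (intro continuous_intros) (use small(3) c in auto)
        fix t assume t: "t \<in> {c<..<b} - S"
        show "(\<phi> has_real_derivative - \<omega>\<^sup>2 - (\<phi> t)\<^sup>2) (at t)"
          unfolding \<phi>_def using small(3)[of "b - t"] c t
          by (auto intro!: derivative_eq_intros simp: sq power2_eq_square algebra_simps)
      qed (use c df in \<open>auto intro: continuous_on_subset[OF f] continuous_on_subset[OF g]\<close>)
      then show ?thesis using c by (simp add: \<phi>_def)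
    qed
    have "F = integral {a..c} (\<lambda>t. (f t)\<^sup>2) + integral {c..b} (\<lambda>t. (f t)\<^sup>2)"
      unfolding F_def using c f2 by (subst Henstock_Kurzweil_Integration.integral_combine) auto
    moreover have "G = integral {a..c} (\<lambda>t. (g t)\<^sup>2) + integral {c..b} (\<lambda>t. (g t)\<^sup>2)"
      unfolding G_def using c g2 by (subst Henstock_Kurzweil_Integration.integral_combine) auto
    ultimately show ?thesis using left right by (simp add: algebra_simps)
  qed
  \<comment> \<open>\<open>\<omega> = sqrt z * \<omega>0\<close> tends to the critical frequency as \<open>z\<close> tends to 1.\<close>
  have "\<omega>0\<^sup>2 * F \<le> G"
  proof (rule field_le_mult_one_interval)
    fix z :: real assume z: "0 < z" "z < 1"
    have "(sqrt z * \<omega>0)\<^sup>2 * F \<le> G" by (rule *) (use z \<omega>0 in auto)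
    then show "z * (\<omega>0\<^sup>2 * F) \<le> G" using z by (simp add: power_mult_distrib)
  qed
  then have "F \<le> G / \<omega>0\<^sup>2" using \<omega>0 by (simp add: field_simps)
  also have "\<dots> = (2 * (b - a) / pi)\<^sup>2 * G" by (simp add: \<omega>0_def power_divide)
  finally show ?thesis by (simp add: F_def G_def)
qed

section \<open>The integrated mismatch of two pulses\<close>

text \<open>
  The integral from 0 to \<open>s\<close> of the difference of two pulses of durations \<open>\<tau>\<close> and \<open>\<tau>0\<close>, both starting
  at 0, minus the mean \<open>(\<tau> - \<tau>0) / T\<close> of that difference over \<open>[0, T]\<close>.  Subtracting the mean
  makes it vanish at both ends of the period.
\<close>

definition pulse_discrepancy :: "real \<Rightarrow> real \<Rightarrow> real \<Rightarrow> real \<Rightarrow> real" where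
  "pulse_discrepancy T \<tau> \<tau>0 s = min s \<tau> - min s \<tau>0 - (\<tau> - \<tau>0) / T * s"

lemma pulse_discrepancy_swap: "pulse_discrepancy T \<tau>0 \<tau> s = - pulse_discrepancy T \<tau> \<tau>0 s"
  by (simp add: pulse_discrepancy_def diff_divide_distrib algebra_simps)

lemma pulse_discrepancy_bound:
  assumes "T > 0" "\<tau> \<in> {0..T}" "\<tau>0 \<in> {0..T}" "s \<in> {0..T}"
  shows "\<bar>pulse_discrepancy T \<tau> \<tau>0 s\<bar> \<le> \<bar>\<tau> - \<tau>0\<bar>"
proof -
  have *: "\<bar>pulse_discrepancy T \<tau> \<tau>0 s\<bar> \<le> \<tau> - \<tau>0"
    if "\<tau>0 \<le> \<tau>" "\<tau> \<in> {0..T}" "\<tau>0 \<in> {0..T}" for \<tau> \<tau>0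
  proof -
    define X where "X = (\<tau> - \<tau>0) / T * s"
    have "X \<le> (\<tau> - \<tau>0) / T * T" "0 \<le> X" unfolding X_def
      using assms that by (intro mult_left_mono mult_nonneg_nonneg divide_nonneg_pos; simp)+
    moreover have "(\<tau> - \<tau>0) / T * T = \<tau> - \<tau>0" using assms by simp
    ultimately show ?thesis
      using that unfolding pulse_discrepancy_def X_def[symmetric] by (auto simp: min_def)
  qed
  show ?thesis
  proof (cases "\<tau>0 \<le> \<tau>")
    case True then show ?thesis using *[of \<tau>0 \<tau>] assms by simp
  next
    case False then show ?thesis using *[of \<tau> \<tau>0] assms pulse_discrepancy_swap[of T \<tau>0 \<tau> s] by simp
  qed
qed

lemma has_integral_affine_square:
  fixes a b k m :: real
  assumes "a \<le> b"
  shows "((\<lambda>s. (k + m * (s - a))\<^sup>2) has_integral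
      k\<^sup>2 * (b - a) + k * m * (b - a)\<^sup>2 + m\<^sup>2 * (b - a) ^ 3 / 3) {a..b}"
proof -
  have "((\<lambda>s. (k + m * (s - a))\<^sup>2) has_integral
      (k\<^sup>2 * (b - a) + k * m * (b - a)\<^sup>2 + m\<^sup>2 * (b - a) ^ 3 / 3)
      - (k\<^sup>2 * (a - a) + k * m * (a - a)\<^sup>2 + m\<^sup>2 * (a - a) ^ 3 / 3)) {a..b}"
    by (rule fundamental_theorem_of_calculus[OF assms])
       (auto intro!: derivative_eq_intros
          simp: has_real_derivative_iff_has_vector_derivative[symmetric] power2_eq_square field_simps)
  then show ?thesis by simp
qed

lemma continuous_on_pulse_discrepancy: "continuous_on S (pulse_discrepancy T \<tau> \<tau>0)"
  unfolding pulse_discrepancy_def by (intro continuous_intros)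

text \<open>
  For \<open>\<tau>0 \<le> \<tau>\<close> and \<open>v = (\<tau> - \<tau>0) / T\<close> the discrepancy is a zigzag with slopes \<open>- v\<close>, \<open>1 - v\<close>, \<open>- v\<close>.
  With \<open>p = \<tau>0\<close> and \<open>r = T - \<tau>\<close> the three pieces add up to
  \<open>v\<^sup>2 T (p\<^sup>2 - p r + r\<^sup>2) / 3\<close>, and \<open>p + r \<le> T\<close>.  The constant \<open>1 / 3\<close> is sharp; the uniform bound
  \<open>\<bar>\<tau> - \<tau>0\<bar>\<close> on the discrepancy would lose this factor.
\<close>

lemma integral_pulse_discrepancy_square:
  assumes "T > 0" "\<tau> \<in> {0..T}" "\<tau>0 \<in> {0..T}"
  shows "integral {0..T} (\<lambda>s. (pulse_discrepancy T \<tau> \<tau>0 s)\<^sup>2) \<le> T * (\<tau> - \<tau>0)\<^sup>2 / 3"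
proof -
  have *: "integral {0..T} (\<lambda>s. (pulse_discrepancy T \<tau> \<tau>0 s)\<^sup>2) \<le> T * (\<tau> - \<tau>0)\<^sup>2 / 3"
    if le: "\<tau>0 \<le> \<tau>" and "\<tau> \<in> {0..T}" "\<tau>0 \<in> {0..T}" for \<tau> \<tau>0
  proof -
    let ?u = "pulse_discrepancy T \<tau> \<tau>0"
    define v where "v = (\<tau> - \<tau>0) / T"
    have vT: "\<tau> = \<tau>0 + v * T" using assms by (simp add: v_def)
    have A: "((\<lambda>s. (?u s)\<^sup>2) has_integral
       0\<^sup>2 * (\<tau>0 - 0) + 0 * - v * (\<tau>0 - 0)\<^sup>2 + (-v)\<^sup>2 * (\<tau>0 - 0) ^ 3 / 3) {0..\<tau>0}"
      by (rule has_integral_eq[OF _ has_integral_affine_square[of 0 \<tau>0 0 "- v"]])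
         (use that in \<open>auto simp: pulse_discrepancy_def v_def\<close>)
    have B: "((\<lambda>s. (?u s)\<^sup>2) has_integral
       (- v * \<tau>0)\<^sup>2 * (\<tau> - \<tau>0) + (- v * \<tau>0) * (1 - v) * (\<tau> - \<tau>0)\<^sup>2
         + (1 - v)\<^sup>2 * (\<tau> - \<tau>0) ^ 3 / 3) {\<tau>0..\<tau>}"
      by (rule has_integral_eq[OF _ has_integral_affine_square[of \<tau>0 \<tau> "- v * \<tau>0" "1 - v"]])
         (use that in \<open>auto simp: pulse_discrepancy_def v_def[symmetric] algebra_simps\<close>)
    have C: "((\<lambda>s. (?u s)\<^sup>2) has_integral
       (v * (T - \<tau>))\<^sup>2 * (T - \<tau>) + (v * (T - \<tau>)) * - v * (T - \<tau>)\<^sup>2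
         + (- v)\<^sup>2 * (T - \<tau>) ^ 3 / 3) {\<tau>..T}"
      by (rule has_integral_eq[OF _ has_integral_affine_square[of \<tau> T "v * (T - \<tau>)" "- v"]])
         (use that in \<open>auto simp: pulse_discrepancy_def v_def[symmetric] vT algebra_simps\<close>)
    define p r where "p = \<tau>0" and "r = T - \<tau>"
    have pr: "0 \<le> p" "0 \<le> r" "p + r \<le> T" using that by (auto simp: p_def r_def)
    have d: "\<tau> - \<tau>0 = v * T" and rr: "r = T - p - v * T" by (auto simp: vT p_def r_def)
    have "integral {0..T} (\<lambda>s. (?u s)\<^sup>2) = v\<^sup>2 * T * (p\<^sup>2 - p * r + r\<^sup>2) / 3"
    proof (rule integral_unique)
      have "((\<lambda>s. (?u s)\<^sup>2) has_integral
         (0\<^sup>2 * (\<tau>0 - 0) + 0 * - v * (\<tau>0 - 0)\<^sup>2 + (-v)\<^sup>2 * (\<tau>0 - 0) ^ 3 / 3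
          + ((- v * \<tau>0)\<^sup>2 * (\<tau> - \<tau>0) + (- v * \<tau>0) * (1 - v) * (\<tau> - \<tau>0)\<^sup>2
             + (1 - v)\<^sup>2 * (\<tau> - \<tau>0) ^ 3 / 3))
          + ((v * (T - \<tau>))\<^sup>2 * (T - \<tau>) + (v * (T - \<tau>)) * - v * (T - \<tau>)\<^sup>2
             + (- v)\<^sup>2 * (T - \<tau>) ^ 3 / 3)) {0..T}"
        using that by (intro has_integral_combine[OF _ _ has_integral_combine[OF _ _ A B] C]) auto
      also have "(0\<^sup>2 * (\<tau>0 - 0) + 0 * - v * (\<tau>0 - 0)\<^sup>2 + (-v)\<^sup>2 * (\<tau>0 - 0) ^ 3 / 3
          + ((- v * \<tau>0)\<^sup>2 * (\<tau> - \<tau>0) + (- v * \<tau>0) * (1 - v) * (\<tau> - \<tau>0)\<^sup>2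
             + (1 - v)\<^sup>2 * (\<tau> - \<tau>0) ^ 3 / 3))
          + ((v * (T - \<tau>))\<^sup>2 * (T - \<tau>) + (v * (T - \<tau>)) * - v * (T - \<tau>)\<^sup>2
             + (- v)\<^sup>2 * (T - \<tau>) ^ 3 / 3)
          = v\<^sup>2 * T * (p\<^sup>2 - p * r + r\<^sup>2) / 3"
        unfolding d unfolding p_def[symmetric] r_def[symmetric] unfolding rr
        by (simp add: field_simps power2_eq_square power3_eq_cube)
      finally show "((\<lambda>s. (?u s)\<^sup>2) has_integral v\<^sup>2 * T * (p\<^sup>2 - p * r + r\<^sup>2) / 3) {0..T}" .
    qed
    also have "\<dots> \<le> v\<^sup>2 * T * T\<^sup>2 / 3"
    proof -
      have "p\<^sup>2 - p * r + r\<^sup>2 \<le> (p + r)\<^sup>2" using pr by (simp add: power2_eq_square algebra_simps)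
      also have "\<dots> \<le> T\<^sup>2" using pr by (intro power_mono) auto
      finally show ?thesis using assms by (intro divide_right_mono mult_left_mono) auto
    qed
    also have "\<dots> = T * (\<tau> - \<tau>0)\<^sup>2 / 3" by (simp add: d power_mult_distrib)
    finally show ?thesis .
  qed
  show ?thesis
  proof (cases "\<tau>0 \<le> \<tau>")
    case True then show ?thesis using *[of \<tau>0 \<tau>] assms by simp
  next
    case False then show ?thesis
      using *[of \<tau> \<tau>0] assms by (simp add: pulse_discrepancy_swap[of T \<tau> \<tau>0] power2_commute)
  qed
qed

lemma pulse_discrepancy_derivative:
  assumes "s \<noteq> \<tau>" "s \<noteq> \<tau>0"
  shows "(pulse_discrepancy T \<tau> \<tau>0 has_real_derivative
           of_bool (s < \<tau>) - of_bool (s < \<tau>0) - (\<tau> - \<tau>0) / T) (at s)"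
proof -
  have m: "((\<lambda>s. min s c) has_real_derivative of_bool (s < c)) (at s)" if "s \<noteq> c" for c :: real
  proof (cases "s < c")
    case True
    have "((\<lambda>s. s) has_real_derivative 1) (at s)" by simp
    then have "((\<lambda>s. min s c) has_real_derivative 1) (at s)"
      by (rule has_field_derivative_transform_within_open[where S = "{..<c}"]) (use True in auto)
    then show ?thesis using True by simp
  next
    case False
    have "((\<lambda>s. c) has_real_derivative 0) (at s)" by simp
    then have "((\<lambda>s. min s c) has_real_derivative 0) (at s)"
      by (rule has_field_derivative_transform_within_open[where S = "{c<..}"]) (use False that in auto)
    then show ?thesis using False by simp
  qed
  show ?thesis unfolding pulse_discrepancy_def
    by (rule derivative_eq_intros m assms refl | simp)+
qed

section \<open>The matrix inequality as a dissipation inequality\<close>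

lemma negative_definite_coercive:
  fixes X :: "real ^ 'n ^ 'n"
  assumes "negative_definite X"
  obtains \<delta> where "\<delta> > 0" "\<And>z. z \<bullet> (X *v z) \<le> - \<delta> * (norm z)\<^sup>2"
proof -
  have "sphere 0 1 \<noteq> ({} :: (real ^ 'n) set)" by simp
  moreover have "continuous_on (sphere 0 1) (\<lambda>z. z \<bullet> (X *v z))"
    by (intro continuous_intros matrix_vector_mult_linear_continuous_on)
  ultimately obtain w where w: "w \<in> sphere 0 1" "\<forall>z \<in> sphere 0 1. z \<bullet> (X *v z) \<le> w \<bullet> (X *v w)"
    using continuous_attains_sup[of "sphere 0 1"] compact_sphere by blast
  have neg: "w \<bullet> (X *v w) < 0"
    using assms w(1) unfolding negative_definite_def
    by (metis mem_sphere_0 norm_zero zero_neq_one)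
  show ?thesis
  proof (rule that[of "- (w \<bullet> (X *v w))"])
    fix z :: "real ^ 'n"
    show "z \<bullet> (X *v z) \<le> - (- (w \<bullet> (X *v w))) * (norm z)\<^sup>2"
    proof (cases "z = 0")
      case False
      define e where "e = (1 / norm z) *\<^sub>R z"
      have z: "z = norm z *\<^sub>R e" and "e \<in> sphere 0 1" using False by (auto simp: e_def)
      then have "e \<bullet> (X *v e) \<le> w \<bullet> (X *v w)" using w by blast
      moreover have "z \<bullet> (X *v z) = (norm z)\<^sup>2 * (e \<bullet> (X *v e))"
        by (subst (1 2) z) (simp add: matrix_vector_mult_scaleR power2_eq_square)
      ultimately show ?thesis by (simp add: mult.commute[of "(norm z)\<^sup>2"] mult_right_mono)
    qed simp
  qed (use neg in simp)
qed

definition block_vector :: "real ^ 'm \<Rightarrow> real ^ 3 \<Rightarrow> real ^ ('m + 3)" where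
  "block_vector y s = (\<chi> i. case i of Inl a \<Rightarrow> y $ a | Inr k \<Rightarrow> s $ k)"

lemma sum_UNIV_sum_type:
  fixes f :: "'a::finite + 'b::finite \<Rightarrow> 'c::comm_monoid_add"
  shows "(\<Sum>i\<in>UNIV. f i) = (\<Sum>a\<in>UNIV. f (Inl a)) + (\<Sum>b\<in>UNIV. f (Inr b))"
  unfolding UNIV_Plus_UNIV[symmetric] by (subst sum.Plus) auto

lemma inner_block_vector:
  "block_vector y s \<bullet> block_vector y' s' = y \<bullet> y' + s \<bullet> s'"
  by (simp add: inner_vec_def block_vector_def sum_UNIV_sum_type)

lemma block_mult_block_vector:
  "block P U V D *v block_vector y s =
     block_vector (P *v y + (\<Sum>k\<in>UNIV. s $ k *\<^sub>R U $ k)) ((\<chi> k. V $ k \<bullet> y) + D *v s)"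
  by (auto simp: vec_eq_iff block_def block_vector_def matrix_vector_mult_def sum_UNIV_sum_type
      inner_vec_def mult.commute split: sum.split)

lemma inner_real_3:
  fixes x y :: "real ^ 3"
  shows "x \<bullet> y = x $ 1 * y $ 1 + x $ 2 * y $ 2 + x $ 3 * y $ 3"
  by (simp add: inner_vec_def sum_3)

lemma matrix_vector_mult_3:
  fixes D :: "real ^ 3 ^ 3"
  shows "(D *v s) $ k = D $ k $ 1 * s $ 1 + D $ k $ 2 * s $ 2 + D $ k $ 3 * s $ 3"
  by (simp add: matrix_vector_mult_def sum_3)

lemma inner_transpose_mult: "x \<bullet> (transpose M *v y) = (M *v x) \<bullet> (y :: real ^ 'n)"
  unfolding transpose_matrix_vector by (metis dot_lmul_matrix inner_commute)

lemma symmetric_inner: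
  assumes "symmetric_matrix H"
  shows "x \<bullet> (H *v y) = (H *v x) \<bullet> y"
  using inner_transpose_mult[of x H y] assms unfolding symmetric_matrix_def by metis

text \<open>
  The term \<open>2 * (y \<bullet> (H *v _))\<close> is the rate of change of \<open>y \<bullet> (H *v y)\<close> along
  \<open>y' = A y + u A B + v B\<close>, and \<open>\<theta>\<close> is the slope of the sector condition that links \<open>v\<close> to the
  output.  The scalar \<open>w\<close> is free: minimising over it leaves a negative multiple of the
  squared rate of change of \<open>C \<bullet> y\<close>.
\<close>

definition dissipation_inequality ::
  "real ^ 'm ^ 'm \<Rightarrow> real ^ 'm \<Rightarrow> real ^ 'm \<Rightarrow> real ^ 'm ^ 'm \<Rightarrow> real \<Rightarrow> real \<Rightarrow> real \<Rightarrow> real \<Rightarrow>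
   real \<Rightarrow> bool" where
  "dissipation_inequality A B C H T \<theta> \<epsilon> \<nu> \<delta> \<longleftrightarrow> (\<forall>y u v w.
     2 * (y \<bullet> (H *v (A *v y + u *\<^sub>R (A *v B) + v *\<^sub>R B)))
       + \<delta> * ((norm y)\<^sup>2 + u\<^sup>2 + v\<^sup>2)
     \<le> - v * (C \<bullet> y) + 3 * \<nu> / T\<^sup>2 * u\<^sup>2
       + (\<theta> - \<nu> - \<epsilon> - T * \<bar>C \<bullet> B\<bar>) * v\<^sup>2
       + 2 * (T / pi) * w * (C \<bullet> (A *v y + u *\<^sub>R (A *v B) + v *\<^sub>R B)) + \<epsilon> * w\<^sup>2)"

text \<open>
  The inequality is the matrix inequality evaluated on \<open>(y, u, v, w)\<close>; the margin \<open>\<delta>\<close> comes from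
  compactness of the unit sphere.
\<close>

lemma dissipation_of_lmi:
  fixes A H :: "real ^ 'm ^ 'm" and B C :: "real ^ 'm"
  assumes H: "symmetric_matrix H" and lmi: "L_matrix A B H \<prec> R_matrix A B C T \<sigma>s L1 \<epsilon> \<nu>"
  obtains \<delta> where "\<delta> > 0" and "dissipation_inequality A B C H T (\<sigma>s - T * L1) \<epsilon> \<nu> \<delta>"
proof -
  let ?X = "L_matrix A B H - R_matrix A B C T \<sigma>s L1 \<epsilon> \<nu>"
  obtain \<delta> where \<delta>: "\<delta> > 0" "\<And>z. z \<bullet> (?X *v z) \<le> - \<delta> * (norm z)\<^sup>2"
    using negative_definite_coercive lmi unfolding definite_less_def by blast
  show ?thesis
  proof (rule that[OF \<delta>(1)], unfold dissipation_inequality_def, intro allI)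
    fix y :: "real ^ 'm" and u v w :: real
    define s :: "real ^ 3" where "s = vector [u, v, w]"
    define z where "z = block_vector y s"
    have "(norm z)\<^sup>2 = (norm y)\<^sup>2 + u\<^sup>2 + v\<^sup>2 + w\<^sup>2"
      unfolding power2_norm_eq_inner z_def inner_block_vector
      by (simp add: s_def inner_real_3 vector_3 power2_eq_square)
    then have le: "(norm y)\<^sup>2 + u\<^sup>2 + v\<^sup>2 \<le> (norm z)\<^sup>2" by simp
    have L: "z \<bullet> (L_matrix A B H *v z) = 2 * (y \<bullet> (H *v (A *v y + u *\<^sub>R (A *v B) + v *\<^sub>R B)))"
    proof -
      have 1: "y \<bullet> (transpose A *v (H *v y)) = y \<bullet> (H *v (A *v y))"
        unfolding inner_transpose_mult symmetric_inner[OF H, of y "A *v y"] by (rule inner_commute)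
      have 2: "((B v* transpose A) v* H) \<bullet> y = y \<bullet> (H *v (A *v B))"
        unfolding vector_transpose_matrix dot_lmul_matrix
        using symmetric_inner[OF H, of y "A *v B"] by (metis inner_commute)
      have 3: "(B v* H) \<bullet> y = y \<bullet> (H *v B)"
        unfolding dot_lmul_matrix using symmetric_inner[OF H, of y B] by (metis inner_commute)
      show ?thesis
        unfolding L_matrix_def z_def block_mult_block_vector inner_block_vector
        using 1 2 3
        by (simp add: s_def inner_real_3 sum_3 vector_3 inner_add_right matrix_vector_mult_3
            matrix_vector_mult_add_rdistrib matrix_vector_mul_assoc[symmetric]
            matrix_vector_right_distrib matrix_vector_mult_scaleR algebra_simps
            del: vector_transpose_matrix transpose_matrix_vector)
    qed
    have R: "z \<bullet> (R_matrix A B C T \<sigma>s L1 \<epsilon> \<nu> *v z) =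
       - v * (C \<bullet> y) + 3 * \<nu> / T\<^sup>2 * u\<^sup>2
           + (\<sigma>s - T * L1 - \<nu> - \<epsilon> - T * \<bar>C \<bullet> B\<bar>) * v\<^sup>2
           + 2 * (T / pi) * w * (C \<bullet> (A *v y + u *\<^sub>R (A *v B) + v *\<^sub>R B)) + \<epsilon> * w\<^sup>2"
    proof -
      have 1: "y \<bullet> (transpose A *v C) = C \<bullet> (A *v y)"
        unfolding inner_transpose_mult by (rule inner_commute)
      have 2: "(C v* A) \<bullet> y = C \<bullet> (A *v y)" by (rule dot_lmul_matrix)
      show ?thesis
        unfolding R_matrix_def Let_def z_def block_mult_block_vector inner_block_vector
        using 1 2
        by (simp add: s_def inner_real_3 sum_3 vector_3 inner_add_right matrix_vector_mult_3
            inner_commute[of C y] power2_eq_square algebra_simps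
            del: vector_transpose_matrix transpose_matrix_vector)
    qed
    have "z \<bullet> (?X *v z) = z \<bullet> (L_matrix A B H *v z) - z \<bullet> (R_matrix A B C T \<sigma>s L1 \<epsilon> \<nu> *v z)"
      by (simp add: matrix_vector_mult_diff_rdistrib inner_diff_right)
    moreover have "\<delta> * ((norm y)\<^sup>2 + u\<^sup>2 + v\<^sup>2) \<le> \<delta> * (norm z)\<^sup>2"
      using \<delta>(1) le by simp
    ultimately show "2 * (y \<bullet> (H *v (A *v y + u *\<^sub>R (A *v B) + v *\<^sub>R B)))
           + \<delta> * ((norm y)\<^sup>2 + u\<^sup>2 + v\<^sup>2)
         \<le> - v * (C \<bullet> y) + 3 * \<nu> / T\<^sup>2 * u\<^sup>2
           + (\<sigma>s - T * L1 - \<nu> - \<epsilon> - T * \<bar>C \<bullet> B\<bar>) * v\<^sup>2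
           + 2 * (T / pi) * w * (C \<bullet> (A *v y + u *\<^sub>R (A *v B) + v *\<^sub>R B)) + \<epsilon> * w\<^sup>2"
      using \<delta>(2)[of z] unfolding L R by linarith
  qed
qed

section \<open>Pulses of a solution\<close>

text \<open>
  One inequality for short pulses and one for long ones treat saturated and unsaturated durations
  alike: at the end of a pulse of duration 0 the input is at or below the ramp, after a pulse of
  duration \<open>T\<close> at or above it, and in between both hold.  Continuity provides the least crossing time.
\<close>

lemma pulse_duration_cases:
  assumes T: "T > 0" and cont: "continuous_on {real n * T..real n * T + T} \<sigma>"
    and \<tau>: "\<tau> = pulse_duration T \<sigma>1 \<sigma>s \<sigma> n"
  shows "\<tau> \<in> {0..T}"
    and "\<tau> < T \<Longrightarrow> \<sigma> (real n * T + \<tau>) \<le> \<sigma>1 + \<sigma>s * \<tau> / T"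
    and "\<tau> > 0 \<Longrightarrow> \<sigma> (real n * T + \<tau>) \<ge> \<sigma>1 + \<sigma>s * \<tau> / T"
proof -
  have "\<tau> \<in> {0..T} \<and> (\<tau> < T \<longrightarrow> \<sigma> (real n * T + \<tau>) \<le> \<sigma>1 + \<sigma>s * \<tau> / T) \<and>
    (\<tau> > 0 \<longrightarrow> \<sigma> (real n * T + \<tau>) \<ge> \<sigma>1 + \<sigma>s * \<tau> / T)"
  proof -
    consider "\<sigma> (real n * T) \<le> \<sigma>1"
      | "\<not> \<sigma> (real n * T) \<le> \<sigma>1" "\<forall>\<tau>\<in>{0..T}. \<sigma> (real n * T + \<tau>) > \<sigma>1 + \<sigma>s * \<tau> / T"
      | (crossing) "\<not> (\<sigma> (real n * T) \<le> \<sigma>1 \<or>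
          (\<forall>\<tau>\<in>{0..T}. \<sigma> (real n * T + \<tau>) > \<sigma>1 + \<sigma>s * \<tau> / T))"
      by blast
    then show ?thesis
    proof cases
      case 1
      then show ?thesis using T by (simp add: \<tau> pulse_duration_def)
    next
      case 2
      then have "\<tau> = T" by (simp add: \<tau> pulse_duration_def)
      moreover have "\<sigma>1 + \<sigma>s * T / T < \<sigma> (real n * T + T)" using 2(2) T
        by (intro bspec[OF 2(2)]) simp
      ultimately show ?thesis using T by auto
    next
      case crossing
      then have c1: "\<not> \<sigma> (real n * T) \<le> \<sigma>1"
        and c2: "\<not> (\<forall>\<tau>\<in>{0..T}. \<sigma> (real n * T + \<tau>) > \<sigma>1 + \<sigma>s * \<tau> / T)" by blast+
      define g where "g = (\<lambda>s. \<sigma> (real n * T + s) - (\<sigma>1 + \<sigma>s * s / T))"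
      have g: "continuous_on {0..T} g" unfolding g_def
        by (intro continuous_intros continuous_on_compose2[OF cont]) (use T in auto)
      define Z where "Z = {s \<in> {0..T}. g s = 0}"
      have Zeq: "Z = {s. s \<in> {0..T} \<and> \<sigma> (real n * T + s) = \<sigma>1 + \<sigma>s * s / T}"
        by (auto simp: Z_def g_def)
      obtain b where b: "b \<in> {0..T}" "g b \<le> 0" using c2 by (force simp: g_def)
      have "\<exists>s. 0 \<le> s \<and> s \<le> b \<and> g s = 0"
        by (rule IVT2') (use b c1 in \<open>auto simp: g_def intro: continuous_on_subset[OF g[unfolded g_def]]\<close>)
      then have "Z \<noteq> {}" using b by (force simp: Z_def)
      have "closed Z" unfolding Z_def
        by (rule continuous_closed_preimage_constant[OF g]) simp
      then have "compact ({0..T} \<inter> Z)" by (rule compact_Int_closed[OF compact_Icc])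
      moreover have "{0..T} \<inter> Z = Z" by (auto simp: Z_def)
      ultimately obtain m where m: "m \<in> Z" "\<forall>s\<in>Z. m \<le> s"
        using \<open>Z \<noteq> {}\<close> compact_attains_inf[of Z] by auto
      have "\<tau> = (LEAST s. s \<in> Z)"
        unfolding \<tau> pulse_duration_def if_not_P[OF c1] if_not_P[OF c2] by (simp add: Zeq)
      also have "\<dots> = m" using m by (intro Least_equality) auto
      finally show ?thesis using m by (auto simp: Zeq)
    qed
  qed
  then show "\<tau> \<in> {0..T}"
    and "\<tau> < T \<Longrightarrow> \<sigma> (real n * T + \<tau>) \<le> \<sigma>1 + \<sigma>s * \<tau> / T"
    and "\<tau> > 0 \<Longrightarrow> \<sigma> (real n * T + \<tau>) \<ge> \<sigma>1 + \<sigma>s * \<tau> / T" by blast+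
qed

lemma modulator_on_period:
  assumes T: "T > 0" and \<tau>: "\<And>k. pulse_duration T \<sigma>1 \<sigma>s \<sigma> k \<in> {0..T}"
    and t: "real n * T \<le> t" "t < real n * T + T"
  shows "modulator T \<sigma>1 \<sigma>s \<sigma> t = of_bool (t < real n * T + pulse_duration T \<sigma>1 \<sigma>s \<sigma> n)"
proof -
  have *: "k = n" if k: "real k * T \<le> t" "t < real k * T + pulse_duration T \<sigma>1 \<sigma>s \<sigma> k" for k
  proof -
    have "t < real k * T + T" using k \<tau>[of k] by auto
    then have "real n * T < real (Suc k) * T" "real k * T < real (Suc n) * T"
      using t k by (auto simp: algebra_simps)
    then have "n < Suc k" "k < Suc n"
      by (simp_all only: mult_less_cancel_right_pos[OF T] of_nat_less_iff)
    then show ?thesis by simp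
  qed
  have "(\<exists>k. real k * T \<le> t \<and> t < real k * T + pulse_duration T \<sigma>1 \<sigma>s \<sigma> k)
      \<longleftrightarrow> t < real n * T + pulse_duration T \<sigma>1 \<sigma>s \<sigma> n"
    using * t(1) by metis
  then show ?thesis by (simp add: modulator_def)
qed

lemma continuous_on_system_output:
  "continuous_on S x \<Longrightarrow> continuous_on S (system_output C \<psi> x)"
  unfolding system_output_def by (intro continuous_intros)

lemma pwm_solution_pulse_cases:
  fixes x :: "real \<Rightarrow> real ^ 'm"
  assumes "pwm_solution A B q C \<psi> T \<sigma>1 \<sigma>s x" "T > 0"
    and "\<tau> = pulse_duration T \<sigma>1 \<sigma>s (system_output C \<psi> x) n"
  shows "\<tau> \<in> {0..T}"
    and "\<tau> < T \<Longrightarrow> system_output C \<psi> x (real n * T + \<tau>) \<le> \<sigma>1 + \<sigma>s * \<tau> / T"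
    and "\<tau> > 0 \<Longrightarrow> system_output C \<psi> x (real n * T + \<tau>) \<ge> \<sigma>1 + \<sigma>s * \<tau> / T"
proof -
  have "continuous_on {0..} x" using assms(1) by (simp add: pwm_solution_def Let_def)
  then have "continuous_on {real n * T..real n * T + T} (system_output C \<psi> x)"
    using assms(2) by (intro continuous_on_system_output) (auto elim!: continuous_on_subset intro: order_trans[of 0 "real n * T"])
  from pulse_duration_cases[OF assms(2) this assms(3)]
  show "\<tau> \<in> {0..T}"
    and "\<tau> < T \<Longrightarrow> system_output C \<psi> x (real n * T + \<tau>) \<le> \<sigma>1 + \<sigma>s * \<tau> / T"
    and "\<tau> > 0 \<Longrightarrow> system_output C \<psi> x (real n * T + \<tau>) \<ge> \<sigma>1 + \<sigma>s * \<tau> / T" by blast+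
qed

text \<open>
  Inside a period the modulator is locally constant away from the end of the pulse, so no other
  instant is a switching instant.
\<close>

lemma pwm_solution_derivative:
  fixes x :: "real \<Rightarrow> real ^ 'm"
  assumes sol: "pwm_solution A B q C \<psi> T \<sigma>1 \<sigma>s x" and T: "T > 0"
    and \<tau>: "\<tau> = pulse_duration T \<sigma>1 \<sigma>s (system_output C \<psi> x) n"
    and t: "t \<in> {real n * T<..<real n * T + T}" "t \<noteq> real n * T + \<tau>"
  shows "(x has_vector_derivative
            A *v x t + of_bool (t < real n * T + \<tau>) *\<^sub>R B + q) (at t)"
proof -
  let ?a = "real n * T"
  define f where "f = modulator T \<sigma>1 \<sigma>s (system_output C \<psi> x)"
  have f: "f s = of_bool (s < ?a + \<tau>)" if "s \<in> {?a<..<?a + T}" for s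
    unfolding f_def \<tau> using that pwm_solution_pulse_cases(1)[OF sol T refl]
    by (intro modulator_on_period[OF T]) auto
  define U where "U = {?a<..<?a + T} \<inter> (if t < ?a + \<tau> then {..<?a + \<tau>} else {?a + \<tau><..})"
  have "t \<in> U" "open U" using t by (auto simp: U_def)
  moreover have "f s = f t" if "s \<in> U" for s
    using that t by (subst (1 2) f) (auto simp: U_def split: if_splits)
  ultimately have "\<forall>\<^sub>F s in at t. f s = f t"
    using eventually_at_topological by blast
  then have "continuous (at t) f"
    unfolding continuous_at by (rule tendsto_eventually)
  have "0 < t" using t T by (auto intro: order.strict_trans1[of 0 ?a])
  have "\<not> switching_instant f t"
    using \<open>continuous (at t) f\<close> by (simp add: switching_instant_def continuous_at_imp_continuous_at_within)
  then have "(x has_vector_derivative A *v x t + f t *\<^sub>R B + q) (at t within {0..})"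
    using sol \<open>0 < t\<close> by (auto simp: pwm_solution_def f_def Let_def)
  moreover have "at t within {0..} = at t"
    using \<open>0 < t\<close> by (intro at_within_interior) (simp add: interior_real_atLeast)
  ultimately show ?thesis using f[OF t(1)] by simp
qed

section \<open>Energy balance over one period\<close>

text \<open>
  What is used of the difference \<open>\<xi>\<close> of two solutions over one period \<open>[a, a + T]\<close>: the forcing
  \<open>q\<close> cancels, the input is the difference of two pulses, and the last conjunct is a sector condition
  between the mean input \<open>(\<tau> - \<tau>0) / T\<close> and the output at the instant \<open>a + \<tau>\<close>.
\<close>

definition mismatch_period ::
  "real ^ 'm ^ 'm \<Rightarrow> real ^ 'm \<Rightarrow> real ^ 'm \<Rightarrow> real \<Rightarrow> real \<Rightarrow> real \<Rightarrow> real \<Rightarrow> real \<Rightarrow>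
   (real \<Rightarrow> real ^ 'm) \<Rightarrow> bool" where
  "mismatch_period A B C \<theta> T a \<tau> \<tau>0 \<xi> \<longleftrightarrow>
     \<tau> \<in> {0..T} \<and> \<tau>0 \<in> {0..T} \<and> continuous_on {a..a + T} \<xi> \<and>
     (\<forall>t\<in>{a<..<a + T} - {a + \<tau>, a + \<tau>0}. (\<xi> has_vector_derivative
        A *v \<xi> t + (of_bool (t < a + \<tau>) - of_bool (t < a + \<tau>0)) *\<^sub>R B) (at t)) \<and>
     \<theta> * ((\<tau> - \<tau>0) / T)\<^sup>2 \<le> (\<tau> - \<tau>0) / T * (C \<bullet> \<xi> (a + \<tau>))"

text \<open>
  Removing the zero-mean part of the input by the change of variables \<open>y = \<xi> - u B\<close> leaves
  \<open>y' = A y + u A B + v B\<close>, where \<open>u\<close> is the pulse discrepancy and \<open>v\<close> the mean input.  The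
  right-hand side has no jumps left; and \<open>y = \<xi>\<close> at both ends of the period, where \<open>u\<close> vanishes.
\<close>

definition reduced_state ::
  "real ^ 'm \<Rightarrow> real \<Rightarrow> real \<Rightarrow> real \<Rightarrow> real \<Rightarrow> (real \<Rightarrow> real ^ 'm) \<Rightarrow> real \<Rightarrow> real ^ 'm" where
  "reduced_state B T a \<tau> \<tau>0 \<xi> t = \<xi> t - pulse_discrepancy T \<tau> \<tau>0 (t - a) *\<^sub>R B"

lemma continuous_on_reduced_state:
  assumes "mismatch_period A B C \<theta> T a \<tau> \<tau>0 \<xi>"
  shows "continuous_on {a..a + T} (reduced_state B T a \<tau> \<tau>0 \<xi>)"
proof -
  have "continuous_on {a..a + T} \<xi>" using assms by (simp add: mismatch_period_def)
  then show ?thesis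
    unfolding reduced_state_def
    by (intro continuous_intros continuous_on_compose2[OF continuous_on_pulse_discrepancy[of UNIV]]) auto
qed

lemma reduced_state_derivative:
  fixes A :: "real ^ 'm ^ 'm"
  assumes "mismatch_period A B C \<theta> T a \<tau> \<tau>0 \<xi>" and t: "t \<in> {a<..<a + T} - {a + \<tau>, a + \<tau>0}"
  shows "(reduced_state B T a \<tau> \<tau>0 \<xi> has_vector_derivative
           A *v reduced_state B T a \<tau> \<tau>0 \<xi> t
             + pulse_discrepancy T \<tau> \<tau>0 (t - a) *\<^sub>R (A *v B) + ((\<tau> - \<tau>0) / T) *\<^sub>R B) (at t)"
proof -
  let ?f = "of_bool (t < a + \<tau>) - of_bool (t < a + \<tau>0) :: real"
  have "((\<lambda>t. pulse_discrepancy T \<tau> \<tau>0 (t - a)) has_real_derivative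
      (of_bool (t - a < \<tau>) - of_bool (t - a < \<tau>0) - (\<tau> - \<tau>0) / T) * 1) (at t)"
    by (rule DERIV_chain2[OF pulse_discrepancy_derivative])
       (use t in \<open>auto intro!: derivative_eq_intros\<close>)
  then have "((\<lambda>t. pulse_discrepancy T \<tau> \<tau>0 (t - a)) has_real_derivative ?f - (\<tau> - \<tau>0) / T) (at t)"
    by (simp add: diff_less_eq add.commute)
  then have u: "((\<lambda>t. pulse_discrepancy T \<tau> \<tau>0 (t - a) *\<^sub>R B) has_vector_derivative
      (?f - (\<tau> - \<tau>0) / T) *\<^sub>R B) (at t)"
    by (auto intro!: derivative_eq_intros)
  have \<xi>: "(\<xi> has_vector_derivative A *v \<xi> t + ?f *\<^sub>R B) (at t)"
    using assms by (simp add: mismatch_period_def)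
  have "(reduced_state B T a \<tau> \<tau>0 \<xi> has_vector_derivative
      A *v \<xi> t + ?f *\<^sub>R B - (?f - (\<tau> - \<tau>0) / T) *\<^sub>R B) (at t)"
    unfolding reduced_state_def by (rule has_vector_derivative_diff[OF \<xi> u])
  also have "A *v \<xi> t + ?f *\<^sub>R B - (?f - (\<tau> - \<tau>0) / T) *\<^sub>R B =
      A *v reduced_state B T a \<tau> \<tau>0 \<xi> t
             + pulse_discrepancy T \<tau> \<tau>0 (t - a) *\<^sub>R (A *v B) + ((\<tau> - \<tau>0) / T) *\<^sub>R B"
    by (simp add: reduced_state_def matrix_vector_mult_diff_distrib matrix_vector_mult_scaleR
        scaleR_left_diff_distrib)
  finally show ?thesis .
qed

lemma reduced_state_endpoints:
  assumes "mismatch_period A B C \<theta> T a \<tau> \<tau>0 \<xi>" and "T > 0"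
  shows "reduced_state B T a \<tau> \<tau>0 \<xi> a = \<xi> a"
    and "reduced_state B T a \<tau> \<tau>0 \<xi> (a + T) = \<xi> (a + T)"
  using assms by (auto simp: reduced_state_def pulse_discrepancy_def mismatch_period_def)

lemma continuous_on_matrix_vector_mult [continuous_intros]:
  fixes M :: "real ^ 'n ^ 'm"
  assumes "continuous_on S f"
  shows "continuous_on S (\<lambda>t. M *v f t)"
  by (rule continuous_on_compose2[OF matrix_vector_mult_linear_continuous_on[of UNIV] assms]) simp

lemma quadratic_form_derivative:
  fixes y :: "real \<Rightarrow> real ^ 'm"
  assumes "symmetric_matrix H" and y: "(y has_vector_derivative y') (at t)"
  shows "((\<lambda>t. y t \<bullet> (H *v y t)) has_vector_derivative 2 * (y t \<bullet> (H *v y'))) (at t)"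
proof -
  have "((\<lambda>t. H *v y t) has_vector_derivative H *v y') (at t)"
    by (rule bounded_linear.has_vector_derivative[OF matrix_vector_mul_bounded_linear y])
  from bounded_bilinear.has_vector_derivative[OF bounded_bilinear_inner y this]
  show ?thesis
    using symmetric_inner[OF assms(1), of y' "y t"] by (simp add: inner_commute)
qed

text \<open>
  Integrate the dissipation inequality along \<open>y\<close>.  Three indefinite terms remain and each is paid
  for: the term in \<open>u\<^sup>2\<close> by \<open>- \<nu> v\<^sup>2\<close> through the zigzag integral; the value of \<open>- v (C \<bullet> y)\<close> at the
  instant \<open>c\<close> where the pulse ends by the sector condition, at a cost \<open>T \<bar>C \<bullet> B\<bar> v\<^sup>2\<close> for passing from
  \<open>\<xi>\<close> to \<open>y\<close>; and the deviation \<open>e\<close> of \<open>C \<bullet> y\<close> from that value by \<open>- \<epsilon> v\<^sup>2\<close> and, through Wirtinger's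
  inequality, by the negative square of the rate of change \<open>C \<bullet> p\<close>.
\<close>

lemma period_energy_balance:
  fixes A H :: "real ^ 'm ^ 'm" and B C :: "real ^ 'm"
  assumes T: "T > 0" and H: "symmetric_matrix H" and pos: "\<epsilon> > 0" "\<nu> > 0"
    and diss: "dissipation_inequality A B C H T \<theta> \<epsilon> \<nu> \<delta>"
    and mis: "mismatch_period A B C \<theta> T a \<tau> \<tau>0 \<xi>"
  shows "\<delta> * integral {a..a + T} (\<lambda>t. (norm (reduced_state B T a \<tau> \<tau>0 \<xi> t))\<^sup>2
             + (pulse_discrepancy T \<tau> \<tau>0 (t - a))\<^sup>2 + ((\<tau> - \<tau>0) / T)\<^sup>2)
         \<le> \<xi> a \<bullet> (H *v \<xi> a) - \<xi> (a + T) \<bullet> (H *v \<xi> (a + T))"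
proof -
  define y where "y = reduced_state B T a \<tau> \<tau>0 \<xi>"
  define u where "u = (\<lambda>t. pulse_discrepancy T \<tau> \<tau>0 (t - a))"
  define v where "v = (\<tau> - \<tau>0) / T"
  define p where "p = (\<lambda>t. A *v y t + u t *\<^sub>R (A *v B) + v *\<^sub>R B)"
  define c where "c = a + \<tau>"
  define e where "e = (\<lambda>t. C \<bullet> y t - C \<bullet> y c)"
  define E where "E = (\<lambda>t. (norm (y t))\<^sup>2 + (u t)\<^sup>2 + v\<^sup>2)"
  have \<tau>: "\<tau> \<in> {0..T}" "\<tau>0 \<in> {0..T}" using mis by (auto simp: mismatch_period_def)
  have c: "c \<in> {a..a + T}" using \<tau> by (auto simp: c_def)
  have cy: "continuous_on {a..a + T} y"
    unfolding y_def by (rule continuous_on_reduced_state[OF mis])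
  have cu: "continuous_on {a..a + T} u" unfolding u_def
    by (intro continuous_on_compose2[OF continuous_on_pulse_discrepancy[of UNIV]] continuous_intros) auto
  have cp: "continuous_on {a..a + T} p" unfolding p_def by (intro continuous_intros cy cu)
  have ce: "continuous_on {a..a + T} e" unfolding e_def by (intro continuous_intros cy)
  have dy: "(y has_vector_derivative p t) (at t)" if "t \<in> {a<..<a + T} - {a + \<tau>, a + \<tau>0}" for t
    unfolding y_def p_def u_def v_def by (rule reduced_state_derivative[OF mis that])

  have I1: "((\<lambda>t. 2 * (y t \<bullet> (H *v p t))) has_integral
      y (a + T) \<bullet> (H *v y (a + T)) - y a \<bullet> (H *v y a)) {a..a + T}"
  proof (rule fundamental_theorem_of_calculus_interior_strong[where S = "{a + \<tau>, a + \<tau>0}"])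
    show "continuous_on {a..a + T} (\<lambda>t. y t \<bullet> (H *v y t))" by (intro continuous_intros cy)
  qed (use T quadratic_form_derivative[OF H dy] in auto)
  have iE: "E integrable_on {a..a + T}" unfolding E_def
    by (intro integrable_continuous_real continuous_intros cy cu)
  have iu: "(\<lambda>t. (u t)\<^sup>2) integrable_on {a..a + T}"
    and ie: "(\<lambda>t. (e t)\<^sup>2) integrable_on {a..a + T}"
    and ip: "(\<lambda>t. (C \<bullet> p t)\<^sup>2) integrable_on {a..a + T}"
    by (intro integrable_continuous_real continuous_intros cu ce cp)+

  have wirtinger: "integral {a..a + T} (\<lambda>t. (e t)\<^sup>2)
      \<le> (2 * T / pi)\<^sup>2 * integral {a..a + T} (\<lambda>t. (C \<bullet> p t)\<^sup>2)"
  proof -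
    have "integral {a..a + T} (\<lambda>t. (e t)\<^sup>2)
      \<le> (2 * (a + T - a) / pi)\<^sup>2 * integral {a..a + T} (\<lambda>t. (C \<bullet> p t)\<^sup>2)"
    proof (rule wirtinger_zero_in_interval[where S = "{a + \<tau>, a + \<tau>0}"])
      show "e c = 0" by (simp add: e_def)
      fix t assume "t \<in> {a<..<a + T} - {a + \<tau>, a + \<tau>0}"
      from bounded_linear.has_vector_derivative[OF bounded_linear_inner_right dy[OF this]]
      have "((\<lambda>t. C \<bullet> y t) has_real_derivative C \<bullet> p t) (at t)"
        by (simp add: has_real_derivative_iff_has_vector_derivative)
      then show "(e has_real_derivative C \<bullet> p t) (at t)"
        unfolding e_def by (auto intro!: derivative_eq_intros)
    qed (use T c in \<open>auto intro!: continuous_intros cp ce\<close>)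
    then show ?thesis by simp
  qed

  have sawtooth: "3 * \<nu> / T\<^sup>2 * integral {a..a + T} (\<lambda>t. (u t)\<^sup>2) \<le> \<nu> * v\<^sup>2 * T"
  proof -
    have "((\<lambda>s. (pulse_discrepancy T \<tau> \<tau>0 s)\<^sup>2) has_integral
        integral {0..T} (\<lambda>s. (pulse_discrepancy T \<tau> \<tau>0 s)\<^sup>2)) {0..T}"
      by (intro integrable_integral integrable_continuous_real continuous_intros
          continuous_on_pulse_discrepancy)
    from has_integral_affinity[OF this[folded cbox_interval], of 1 "- a"]
    have "integral {a..a + T} (\<lambda>t. (u t)\<^sup>2)
        = integral {0..T} (\<lambda>s. (pulse_discrepancy T \<tau> \<tau>0 s)\<^sup>2)"
      by (intro integral_unique) (simp add: u_def add.commute)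
    also have "\<dots> \<le> T * (\<tau> - \<tau>0)\<^sup>2 / 3"
      by (rule integral_pulse_discrepancy_square[OF T \<tau>])
    also have "\<dots> = T * (v * T)\<^sup>2 / 3" using T by (simp add: v_def)
    finally have "3 * \<nu> / T\<^sup>2 * integral {a..a + T} (\<lambda>t. (u t)\<^sup>2)
        \<le> 3 * \<nu> / T\<^sup>2 * (T * (v * T)\<^sup>2 / 3)"
      using pos T by (intro mult_left_mono) auto
    also have "\<dots> = \<nu> * v\<^sup>2 * T" using T by (simp add: field_simps power2_eq_square)
    finally show ?thesis .
  qed

  have sector: "(\<theta> - T * \<bar>C \<bullet> B\<bar>) * v\<^sup>2 \<le> v * (C \<bullet> y c)"
  proof -
    have "\<bar>u c\<bar> \<le> \<bar>\<tau> - \<tau>0\<bar>"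
      unfolding u_def using pulse_discrepancy_bound[OF T \<tau>] \<tau> by (simp add: c_def)
    also have "\<dots> = T * \<bar>v\<bar>" using T by (simp add: v_def abs_mult)
    finally have "\<bar>v\<bar> * \<bar>C \<bullet> B\<bar> * \<bar>u c\<bar> \<le> \<bar>v\<bar> * \<bar>C \<bullet> B\<bar> * (T * \<bar>v\<bar>)"
      by (intro mult_left_mono) auto
    then have "\<bar>v * (u c * (C \<bullet> B))\<bar> \<le> T * \<bar>C \<bullet> B\<bar> * v\<^sup>2"
      by (simp only: abs_mult mult_ac power2_eq_square flip: abs_mult_self_eq[of v])
    moreover have "\<theta> * v\<^sup>2 \<le> v * (C \<bullet> \<xi> c)"
      using mis by (simp add: mismatch_period_def v_def c_def)
    moreover have "v * (C \<bullet> y c) = v * (C \<bullet> \<xi> c) - v * (u c * (C \<bullet> B))"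
      by (simp add: y_def reduced_state_def u_def inner_diff_right right_diff_distrib)
    ultimately show ?thesis by (simp add: left_diff_distrib abs_le_iff)
  qed

  have pointwise: "2 * (y t \<bullet> (H *v p t)) + \<delta> * E t
      \<le> 3 * \<nu> / T\<^sup>2 * (u t)\<^sup>2 - \<nu> * v\<^sup>2 + (e t)\<^sup>2 / (4 * \<epsilon>) - (T / pi)\<^sup>2 / \<epsilon> * (C \<bullet> p t)\<^sup>2" for t
  proof -
    define g where "g = C \<bullet> p t"
    \<comment> \<open>the minimiser over the free variable \<open>w\<close>\<close>
    define w where "w = - (T / pi) * g / \<epsilon>"
    have w: "2 * (T / pi) * w * g + \<epsilon> * w\<^sup>2 = - ((T / pi)\<^sup>2 / \<epsilon> * g\<^sup>2)"
      using pos by (simp add: w_def field_simps power2_eq_square)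
    have "0 \<le> (2 * \<epsilon> * v + e t)\<^sup>2 / (4 * \<epsilon>)" using pos by simp
    also have "\<dots> = \<epsilon> * v\<^sup>2 + v * e t + (e t)\<^sup>2 / (4 * \<epsilon>)"
      using pos by (simp add: field_simps power2_eq_square)
    finally have young: "- v * e t \<le> \<epsilon> * v\<^sup>2 + (e t)\<^sup>2 / (4 * \<epsilon>)" by simp
    have "- v * (C \<bullet> y t) = - v * e t - v * (C \<bullet> y c)" by (simp add: e_def algebra_simps)
    then have "- v * (C \<bullet> y t) + (\<theta> - \<nu> - \<epsilon> - T * \<bar>C \<bullet> B\<bar>) * v\<^sup>2
        \<le> (e t)\<^sup>2 / (4 * \<epsilon>) - \<nu> * v\<^sup>2"
      using young sector by (simp add: algebra_simps)
    then show ?thesis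
      using diss[unfolded dissipation_inequality_def, rule_format, of "y t" "u t" v w] w by (simp add: p_def E_def g_def)
  qed

  have "y (a + T) \<bullet> (H *v y (a + T)) - y a \<bullet> (H *v y a) + \<delta> * integral {a..a + T} E
      \<le> 3 * \<nu> / T\<^sup>2 * integral {a..a + T} (\<lambda>t. (u t)\<^sup>2) - \<nu> * v\<^sup>2 * T
        + integral {a..a + T} (\<lambda>t. (e t)\<^sup>2) / (4 * \<epsilon>)
        - (T / pi)\<^sup>2 / \<epsilon> * integral {a..a + T} (\<lambda>t. (C \<bullet> p t)\<^sup>2)"
  proof (rule has_integral_le[OF _ _ pointwise])
    show "((\<lambda>t. 2 * (y t \<bullet> (H *v p t)) + \<delta> * E t) has_integral
        y (a + T) \<bullet> (H *v y (a + T)) - y a \<bullet> (H *v y a) + \<delta> * integral {a..a + T} E) {a..a + T}"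
      by (intro has_integral_add I1 has_integral_mult_right integrable_integral iE)
    have "((\<lambda>t. \<nu> * v\<^sup>2) has_integral \<nu> * v\<^sup>2 * T) {a..a + T}"
      using has_integral_const_real[of "\<nu> * v\<^sup>2" a "a + T"] T by (simp add: mult.commute)
    then show "((\<lambda>t. 3 * \<nu> / T\<^sup>2 * (u t)\<^sup>2 - \<nu> * v\<^sup>2 + (e t)\<^sup>2 / (4 * \<epsilon>)
          - (T / pi)\<^sup>2 / \<epsilon> * (C \<bullet> p t)\<^sup>2) has_integral
        3 * \<nu> / T\<^sup>2 * integral {a..a + T} (\<lambda>t. (u t)\<^sup>2) - \<nu> * v\<^sup>2 * T
        + integral {a..a + T} (\<lambda>t. (e t)\<^sup>2) / (4 * \<epsilon>)
        - (T / pi)\<^sup>2 / \<epsilon> * integral {a..a + T} (\<lambda>t. (C \<bullet> p t)\<^sup>2)) {a..a + T}"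
      by (intro has_integral_add has_integral_diff has_integral_mult_right has_integral_divide
          integrable_integral iu ie ip)
  qed
  also have "\<dots> \<le> 0"
  proof -
    have "integral {a..a + T} (\<lambda>t. (e t)\<^sup>2) / (4 * \<epsilon>)
        \<le> (2 * T / pi)\<^sup>2 * integral {a..a + T} (\<lambda>t. (C \<bullet> p t)\<^sup>2) / (4 * \<epsilon>)"
      using wirtinger pos by (intro divide_right_mono) auto
    also have "\<dots> = (T / pi)\<^sup>2 / \<epsilon> * integral {a..a + T} (\<lambda>t. (C \<bullet> p t)\<^sup>2)"
      using pos by (simp add: field_simps power2_eq_square)
    finally show ?thesis using sawtooth by simp
  qed
  finally show ?thesis
    using reduced_state_endpoints[OF mis T] by (simp add: E_def y_def u_def v_def)
qed

text \<open>
  The rate of change of \<open>(norm y)\<^sup>2\<close> is at most a multiple of the integrand, so over one period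
  \<open>(norm y)\<^sup>2\<close> oscillates by at most a multiple of the integral, and somewhere it is at most its mean.
  \<open>K\<close> is the same for all periods and all trajectories.
\<close>

lemma sup_bound_by_energy:
  fixes A :: "real ^ 'm ^ 'm" and B :: "real ^ 'm"
  assumes T: "T > 0"
  obtains K where "K > 0"
    and "\<And>a S y u v t0. finite S \<Longrightarrow> continuous_on {a..a + T} y \<Longrightarrow> continuous_on {a..a + T} u \<Longrightarrow>
      (\<And>t. t \<in> {a<..<a + T} - S \<Longrightarrow>
        (y has_vector_derivative A *v y t + u t *\<^sub>R (A *v B) + v *\<^sub>R B) (at t)) \<Longrightarrow>
      t0 \<in> {a..a + T} \<Longrightarrow>
      (norm (y t0))\<^sup>2 \<le> K * integral {a..a + T} (\<lambda>t. (norm (y t))\<^sup>2 + (u t)\<^sup>2 + v\<^sup>2)"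
proof -
  obtain \<alpha> where \<alpha>: "\<alpha> > 0" "\<And>y. norm (A *v y) \<le> norm y * \<alpha>"
    using bounded_linear.pos_bounded[OF matrix_vector_mul_bounded_linear[of A]] by blast
  define K where "K = 2 * \<alpha> + norm (A *v B) + norm B"
  have K: "K > 0" using \<alpha>(1) by (simp add: K_def add_pos_nonneg)
  have rate: "\<bar>2 * (y \<bullet> (A *v y + u *\<^sub>R (A *v B) + v *\<^sub>R B))\<bar> \<le> K * ((norm y)\<^sup>2 + u\<^sup>2 + v\<^sup>2)"
    for y u v
  proof -
    let ?r = "norm y"
    have amgm: "2 * (?r * \<bar>z\<bar>) \<le> ?r\<^sup>2 + z\<^sup>2" for z :: real
      using sum_squares_bound[of ?r "\<bar>z\<bar>"] by (simp add: mult.assoc)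
    have "norm (A *v y + u *\<^sub>R (A *v B) + v *\<^sub>R B) \<le> ?r * \<alpha> + \<bar>u\<bar> * norm (A *v B) + \<bar>v\<bar> * norm B"
      using \<alpha>(2)[of y] by (intro norm_triangle_le add_mono) auto
    then have "?r * norm (A *v y + u *\<^sub>R (A *v B) + v *\<^sub>R B)
        \<le> ?r * (?r * \<alpha> + \<bar>u\<bar> * norm (A *v B) + \<bar>v\<bar> * norm B)"
      by (rule mult_left_mono) simp
    then have "\<bar>y \<bullet> (A *v y + u *\<^sub>R (A *v B) + v *\<^sub>R B)\<bar>
        \<le> ?r * (?r * \<alpha> + \<bar>u\<bar> * norm (A *v B) + \<bar>v\<bar> * norm B)"
      using Cauchy_Schwarz_ineq2 order_trans by blast
    then have "\<bar>2 * (y \<bullet> (A *v y + u *\<^sub>R (A *v B) + v *\<^sub>R B))\<bar>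
        \<le> 2 * \<alpha> * ?r\<^sup>2 + norm (A *v B) * (2 * (?r * \<bar>u\<bar>)) + norm B * (2 * (?r * \<bar>v\<bar>))"
      by (simp add: abs_mult power2_eq_square algebra_simps)
    also have "\<dots> \<le> 2 * \<alpha> * ?r\<^sup>2 + norm (A *v B) * (?r\<^sup>2 + u\<^sup>2) + norm B * (?r\<^sup>2 + v\<^sup>2)"
      by (intro add_mono mult_left_mono amgm order_refl) auto
    also have "\<dots> \<le> K * (?r\<^sup>2 + u\<^sup>2 + v\<^sup>2)"
      using \<alpha>(1) by (simp add: K_def algebra_simps)
    finally show ?thesis .
  qed
  show ?thesis
  proof (rule that[of "1 / T + K"])
    show "1 / T + K > 0" using T K by (simp add: add_pos_pos)
    fix a v t0 :: real and S and y :: "real \<Rightarrow> real ^ 'm" and u :: "real \<Rightarrow> real"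
    assume S: "finite S" and cy: "continuous_on {a..a + T} y" and cu: "continuous_on {a..a + T} u"
      and dy: "\<And>t. t \<in> {a<..<a + T} - S \<Longrightarrow>
        (y has_vector_derivative A *v y t + u t *\<^sub>R (A *v B) + v *\<^sub>R B) (at t)"
      and t0: "t0 \<in> {a..a + T}"
    define h where "h = (\<lambda>t. (norm (y t))\<^sup>2)"
    define E where "E = (\<lambda>t. (norm (y t))\<^sup>2 + (u t)\<^sup>2 + v\<^sup>2)"
    define h' where "h' = (\<lambda>t. 2 * (y t \<bullet> (A *v y t + u t *\<^sub>R (A *v B) + v *\<^sub>R B)))"
    have E0: "0 \<le> E t" for t by (simp add: E_def)
    have cE: "continuous_on {a..a + T} E" unfolding E_def by (intro continuous_intros cy cu)
    then have iE: "E integrable_on {a..a + T}" by (rule integrable_continuous_real)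
    have ch: "continuous_on {a..a + T} h" unfolding h_def by (intro continuous_intros cy)
    have osc: "\<bar>h t - h s\<bar> \<le> K * integral {a..a + T} E"
      if st: "a \<le> s" "s \<le> t" "t \<le> a + T" for s t
    proof -
      have iE': "(E has_integral integral {s..t} E) {s..t}"
        using st by (intro integrable_integral integrable_continuous_real continuous_on_subset[OF cE]) auto
      have "(h' has_integral h t - h s) {s..t}"
      proof (rule fundamental_theorem_of_calculus_interior_strong[OF S st(2)])
        fix r assume "r \<in> {s<..<t} - S"
        then have r: "(y has_vector_derivative A *v y r + u r *\<^sub>R (A *v B) + v *\<^sub>R B) (at r)"
          using st by (intro dy) auto
        from bounded_bilinear.has_vector_derivative[OF bounded_bilinear_inner r r]
        show "(h has_vector_derivative h' r) (at r)"
          by (simp add: h_def h'_def power2_norm_eq_inner inner_commute)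
      qed (use st in \<open>auto intro: continuous_on_subset[OF ch]\<close>)
      moreover have "h' r \<le> K * E r" "- (K * E r) \<le> h' r" for r
        using rate[of "y r" "u r" v] by (auto simp: h'_def E_def abs_le_iff)
      ultimately have "h t - h s \<le> K * integral {s..t} E" "- (K * integral {s..t} E) \<le> h t - h s"
        by (auto intro!: has_integral_le[where i = "h t - h s"] has_integral_le[where j = "h t - h s"]
            has_integral_neg has_integral_mult_right iE')
      moreover have "K * integral {s..t} E \<le> K * integral {a..a + T} E"
        using st K iE iE' E0 by (intro mult_left_mono integral_subset_le) auto
      ultimately show ?thesis by (simp add: abs_le_iff)
    qed
    have "((\<lambda>t. h t0 - K * integral {a..a + T} E) has_integral
        T * (h t0 - K * integral {a..a + T} E)) {a..a + T}"
      using has_integral_const_real[of "h t0 - K * integral {a..a + T} E" a "a + T"] T by simp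
    moreover have "h t0 - K * integral {a..a + T} E \<le> E t" if "t \<in> {a..a + T}" for t
    proof -
      have "h t0 - h t \<le> K * integral {a..a + T} E"
        using osc[of t t0] osc[of t0 t] that t0 by (cases "t \<le> t0") (auto simp: abs_le_iff)
      moreover have "h t \<le> E t" by (simp add: h_def E_def)
      ultimately show ?thesis by simp
    qed
    ultimately have "T * (h t0 - K * integral {a..a + T} E) \<le> integral {a..a + T} E"
      using iE by (intro has_integral_le[OF _ integrable_integral]) auto
    then have "h t0 \<le> (1 / T + K) * integral {a..a + T} E"
      using T by (simp add: field_simps)
    then show "(norm (y t0))\<^sup>2
        \<le> (1 / T + K) * integral {a..a + T} (\<lambda>t. (norm (y t))\<^sup>2 + (u t)\<^sup>2 + v\<^sup>2)"
      by (simp add: h_def E_def)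
  qed
qed

text \<open>
  The energy balance controls the integral in the uniform bound on \<open>y\<close>, and going back from \<open>y\<close> to
  \<open>\<xi> = y + u B\<close> is harmless because \<open>\<bar>u\<bar> \<le> \<bar>\<tau> - \<tau>0\<bar>\<close>.  Convergence and Lyapunov stability both rest
  on \<open>M\<close> being the same for all trajectories and periods.
\<close>

lemma period_estimate:
  fixes A H :: "real ^ 'm ^ 'm" and B C :: "real ^ 'm"
  assumes T: "T > 0" and H: "symmetric_matrix H" and pos: "\<epsilon> > 0" "\<nu> > 0" "\<delta> > 0"
    and diss: "dissipation_inequality A B C H T \<theta> \<epsilon> \<nu> \<delta>"
  obtains M where "M > 0"
    and "\<And>a \<tau> \<tau>0 \<xi> t. mismatch_period A B C \<theta> T a \<tau> \<tau>0 \<xi> \<Longrightarrow> t \<in> {a..a + T} \<Longrightarrow>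
      (norm (\<xi> t))\<^sup>2 \<le> M * (\<xi> a \<bullet> (H *v \<xi> a) - \<xi> (a + T) \<bullet> (H *v \<xi> (a + T)))"
    and "\<And>a \<tau> \<tau>0 \<xi>. mismatch_period A B C \<theta> T a \<tau> \<tau>0 \<xi> \<Longrightarrow>
      (\<tau> - \<tau>0)\<^sup>2 \<le> M * (\<xi> a \<bullet> (H *v \<xi> a) - \<xi> (a + T) \<bullet> (H *v \<xi> (a + T)))"
proof -
  obtain K where K: "K > 0" and sup: "\<And>a S y u v t0. finite S \<Longrightarrow> continuous_on {a..a + T} y \<Longrightarrow>
      continuous_on {a..a + T} u \<Longrightarrow>
      (\<And>t. t \<in> {a<..<a + T} - S \<Longrightarrow>
        (y has_vector_derivative A *v y t + u t *\<^sub>R (A *v B) + v *\<^sub>R B) (at t)) \<Longrightarrow>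
      t0 \<in> {a..a + T} \<Longrightarrow>
      (norm (y t0))\<^sup>2 \<le> K * integral {a..a + T} (\<lambda>t. (norm (y t))\<^sup>2 + (u t)\<^sup>2 + v\<^sup>2)"
    using sup_bound_by_energy[OF T, of A B] by blast
  define M0 where "M0 = 2 * K + 2 * (norm B)\<^sup>2 * T + T"
  have M0: "M0 > 0" using K T by (simp add: M0_def add_pos_nonneg)
  have main: "(norm (\<xi> t))\<^sup>2 \<le> M0 / \<delta> * (\<xi> a \<bullet> (H *v \<xi> a) - \<xi> (a + T) \<bullet> (H *v \<xi> (a + T))) \<and>
      (\<tau> - \<tau>0)\<^sup>2 \<le> M0 / \<delta> * (\<xi> a \<bullet> (H *v \<xi> a) - \<xi> (a + T) \<bullet> (H *v \<xi> (a + T)))"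
    if mis: "mismatch_period A B C \<theta> T a \<tau> \<tau>0 \<xi>" and t: "t \<in> {a..a + T}" for a \<tau> \<tau>0 \<xi> t
  proof -
    define y where "y = reduced_state B T a \<tau> \<tau>0 \<xi>"
    define u where "u = (\<lambda>t. pulse_discrepancy T \<tau> \<tau>0 (t - a))"
    define v where "v = (\<tau> - \<tau>0) / T"
    define I where "I = integral {a..a + T} (\<lambda>t. (norm (y t))\<^sup>2 + (u t)\<^sup>2 + v\<^sup>2)"
    have \<tau>: "\<tau> \<in> {0..T}" "\<tau>0 \<in> {0..T}" using mis by (auto simp: mismatch_period_def)
    have cy: "continuous_on {a..a + T} y"
      unfolding y_def by (rule continuous_on_reduced_state[OF mis])
    have cu: "continuous_on {a..a + T} u" unfolding u_def
      by (intro continuous_on_compose2[OF continuous_on_pulse_discrepancy[of UNIV]] continuous_intros) auto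
    have y: "(norm (y t))\<^sup>2 \<le> K * I" unfolding I_def
    proof (rule sup[OF _ cy cu _ t, of "{a + \<tau>, a + \<tau>0}"])
      fix r assume "r \<in> {a<..<a + T} - {a + \<tau>, a + \<tau>0}"
      then show "(y has_vector_derivative A *v y r + u r *\<^sub>R (A *v B) + v *\<^sub>R B) (at r)"
        unfolding y_def u_def v_def by (rule reduced_state_derivative[OF mis])
    qed simp
    have "T * v\<^sup>2 \<le> I" unfolding I_def
    proof (rule has_integral_le[OF _ integrable_integral])
      show "((\<lambda>_. v\<^sup>2) has_integral T * v\<^sup>2) {a..a + T}"
        using has_integral_const_real[of "v\<^sup>2" a "a + T"] T by simp
      show "(\<lambda>t. (norm (y t))\<^sup>2 + (u t)\<^sup>2 + v\<^sup>2) integrable_on {a..a + T}"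
        by (intro integrable_continuous_real continuous_intros cy cu)
    qed simp
    then have "T * (T * v\<^sup>2) \<le> T * I" using T by (intro mult_left_mono) auto
    moreover have "\<tau> - \<tau>0 = T * v" using T by (simp add: v_def)
    ultimately have d: "(\<tau> - \<tau>0)\<^sup>2 \<le> T * I" by (simp add: power2_eq_square mult_ac)
    then have I0: "0 \<le> I" using T zero_le_power2 by (metis order_trans zero_le_mult_iff not_less)
    have "\<bar>u t\<bar> \<le> \<bar>\<tau> - \<tau>0\<bar>" unfolding u_def
      using t by (intro pulse_discrepancy_bound[OF T \<tau>]) auto
    then have "(u t)\<^sup>2 \<le> T * I" using d by (metis abs_le_square_iff order_trans)
    then have u: "(u t)\<^sup>2 * (norm B)\<^sup>2 \<le> T * I * (norm B)\<^sup>2" by (rule mult_right_mono) simp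
    have "\<xi> t = y t + u t *\<^sub>R B" by (simp add: y_def u_def reduced_state_def)
    then have "(norm (\<xi> t))\<^sup>2 \<le> (norm (y t) + norm (u t *\<^sub>R B))\<^sup>2"
      by (metis norm_triangle_ineq norm_ge_zero power_mono)
    also have "\<dots> \<le> 2 * (norm (y t))\<^sup>2 + 2 * ((u t)\<^sup>2 * (norm B)\<^sup>2)"
      using sum_squares_bound[of "norm (y t)" "norm (u t *\<^sub>R B)"]
      by (simp add: power2_sum power_mult_distrib algebra_simps)
    also have "\<dots> \<le> 2 * (K * I) + 2 * (T * I * (norm B)\<^sup>2)" using y u by simp
    also have "\<dots> \<le> M0 * I" using I0 T by (simp add: M0_def algebra_simps)
    finally have 1: "(norm (\<xi> t))\<^sup>2 \<le> M0 * I" .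
    have "T * I \<le> M0 * I" using I0 T K by (intro mult_right_mono) (auto simp: M0_def)
    with d have 2: "(\<tau> - \<tau>0)\<^sup>2 \<le> M0 * I" by simp
    have "\<delta> * I \<le> \<xi> a \<bullet> (H *v \<xi> a) - \<xi> (a + T) \<bullet> (H *v \<xi> (a + T))"
      unfolding I_def y_def u_def v_def by (rule period_energy_balance[OF T H pos(1,2) diss mis])
    then have "M0 / \<delta> * (\<delta> * I)
        \<le> M0 / \<delta> * (\<xi> a \<bullet> (H *v \<xi> a) - \<xi> (a + T) \<bullet> (H *v \<xi> (a + T)))"
      using M0 pos by (intro mult_left_mono) auto
    then show ?thesis using 1 2 pos by simp
  qed
  show ?thesis
  proof (rule that[of "M0 / \<delta>"])
    show "M0 / \<delta> > 0" using M0 pos by simp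
    show "(\<tau> - \<tau>0)\<^sup>2 \<le> M0 / \<delta> * (\<xi> a \<bullet> (H *v \<xi> a) - \<xi> (a + T) \<bullet> (H *v \<xi> (a + T)))"
      if "mismatch_period A B C \<theta> T a \<tau> \<tau>0 \<xi>" for a \<tau> \<tau>0 \<xi>
      using main[OF that, of a] T by simp
  qed (use main in blast)
qed

section \<open>The difference of two solutions\<close>

lemma unsaturated_pulse_duration:
  assumes T: "T > 0" and \<tau>0: "\<tau>0 \<in> {0..T}"
    and dur: "\<forall>n. pulse_duration T \<sigma>1 \<sigma>s \<sigma> n = \<tau>0"
    and unsat: "unsaturated (modulator T \<sigma>1 \<sigma>s \<sigma>)"
  shows "0 < \<tau>0" "\<tau>0 < T"
proof -
  have "modulator T \<sigma>1 \<sigma>s \<sigma> t = 0" if "\<tau>0 = 0" for t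
  proof -
    have "\<not> (\<exists>n. real n * T \<le> t \<and> t < real n * T + pulse_duration T \<sigma>1 \<sigma>s \<sigma> n)"
      using dur that by auto
    then show ?thesis by (simp add: modulator_def)
  qed
  then have "\<tau>0 \<noteq> 0" using unsat by (auto simp: unsaturated_def)
  then show "0 < \<tau>0" using \<tau>0 by simp
  have "modulator T \<sigma>1 \<sigma>s \<sigma> t = 1" if "\<tau>0 = T" "t \<ge> 0" for t
  proof -
    have "real (nat \<lfloor>t / T\<rfloor>) * T \<le> t \<and> t < real (nat \<lfloor>t / T\<rfloor>) * T + T"
      using floor_divide_lower[OF T, of t] floor_divide_upper[OF T, of t] that T
      by (simp add: of_nat_nat algebra_simps)
    then show ?thesis using dur that unfolding modulator_def by auto
  qed
  then have "\<tau>0 \<noteq> T" using unsat by (auto simp: unsaturated_def)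
  then show "\<tau>0 < T" using \<tau>0 by simp
qed

text \<open>
  The sector condition compares the two signals at the instant \<open>a + \<tau>\<close>.  There the perturbed signal
  lies on the correct side of the ramp, while the reference signal meets the ramp at \<open>a + \<tau>0\<close>
  (because \<open>0 < \<tau>0 < T\<close>) and drifts by at most \<open>L1 \<bar>\<tau> - \<tau>0\<bar>\<close> between the two instants.  No switching
  of the reference solution happens strictly between them, so the mean value theorem applies.
\<close>

lemma mismatch_period_of_solutions:
  fixes x x0 :: "real \<Rightarrow> real ^ 'm"
  assumes T: "T > 0"
    and x: "pwm_solution A B q C \<psi> T \<sigma>1 \<sigma>s x" and x0: "pwm_solution A B q C \<psi> T \<sigma>1 \<sigma>s x0"
    and \<tau>: "\<tau> = pulse_duration T \<sigma>1 \<sigma>s (system_output C \<psi> x) n"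
    and \<tau>0: "\<tau>0 = pulse_duration T \<sigma>1 \<sigma>s (system_output C \<psi> x0) n" "0 < \<tau>0" "\<tau>0 < T"
    and L1: "\<forall>t\<ge>0. \<forall>d. (system_output C \<psi> x0 has_real_derivative d) (at t within {0..}) \<longrightarrow> \<bar>d\<bar> \<le> L1"
  shows "mismatch_period A B C (\<sigma>s - T * L1) T (real n * T) \<tau> \<tau>0 (\<lambda>t. x t - x0 t)"
proof -
  let ?a = "real n * T"
  let ?s = "system_output C \<psi> x" and ?ref = "system_output C \<psi> x0"
  have cont: "continuous_on {0..} x" "continuous_on {0..} x0"
    using x x0 by (auto simp: pwm_solution_def Let_def)
  have a: "0 \<le> ?a" using T by simp
  note px = pwm_solution_pulse_cases[OF x T \<tau>]
  note px0 = pwm_solution_pulse_cases[OF x0 T \<tau>0(1)]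
  have lip: "\<bar>?ref (?a + r) - ?ref (?a + p)\<bar> \<le> L1 * (r - p)"
    if pr: "0 \<le> p" "p < r" "r \<le> T" "\<tau>0 \<notin> {p<..<r}" for p r
  proof -
    have der: "(?ref has_real_derivative
        C \<bullet> (A *v x0 z + of_bool (z < ?a + \<tau>0) *\<^sub>R B + q)) (at z)"
      if "?a + p < z" "z < ?a + r" for z
    proof -
      have "(x0 has_vector_derivative A *v x0 z + of_bool (z < ?a + \<tau>0) *\<^sub>R B + q) (at z)"
        using that pr by (intro pwm_solution_derivative[OF x0 T \<tau>0(1)]) auto
      from bounded_linear.has_vector_derivative[OF bounded_linear_inner_right this]
      have "((\<lambda>z. C \<bullet> x0 z) has_real_derivative
          C \<bullet> (A *v x0 z + of_bool (z < ?a + \<tau>0) *\<^sub>R B + q)) (at z)"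
        by (simp only: has_real_derivative_iff_has_vector_derivative)
      then show ?thesis unfolding system_output_def by (auto intro!: derivative_eq_intros)
    qed
    have "continuous_on {?a + p..?a + r} ?ref"
      using a pr by (intro continuous_on_system_output continuous_on_subset[OF cont(2)]) auto
    moreover have "?ref differentiable (at z)" if "?a + p < z" "z < ?a + r" for z
      using der[OF that] real_differentiable_def by blast
    ultimately obtain l z where z: "?a + p < z" "z < ?a + r" "(?ref has_real_derivative l) (at z)"
      "?ref (?a + r) - ?ref (?a + p) = (?a + r - (?a + p)) * l"
      using MVT[of "?a + p" "?a + r" ?ref] pr by auto
    have "\<bar>l\<bar> \<le> L1" using L1 z a pr has_field_derivative_at_within by (metis add_nonneg_nonneg less_imp_le order_trans)
    then have "(r - p) * \<bar>l\<bar> \<le> (r - p) * L1" using pr by (intro mult_left_mono) auto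
    then show ?thesis using z(4) pr by (simp add: abs_mult mult.commute)
  qed
  have s0: "?ref (?a + \<tau>0) = \<sigma>1 + \<sigma>s * \<tau>0 / T" using px0(2,3) \<tau>0 by (intro antisym) auto
  define v where "v = (\<tau> - \<tau>0) / T"
  have \<tau>v: "\<tau> - \<tau>0 = T * v" using T by (simp add: v_def)
  have ramp: "\<sigma>1 + \<sigma>s * \<tau> / T - (\<sigma>1 + \<sigma>s * \<tau>0 / T) = \<sigma>s * v"
    by (simp add: v_def right_diff_distrib diff_divide_distrib)
  have C: "C \<bullet> (x (?a + \<tau>) - x0 (?a + \<tau>)) = ?s (?a + \<tau>) - ?ref (?a + \<tau>)"
    by (simp only: system_output_def inner_diff_right add_diff_cancel_right)
  have "(\<sigma>s - T * L1) * v\<^sup>2 \<le> v * (?s (?a + \<tau>) - ?ref (?a + \<tau>))"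
  proof (cases \<tau>0 \<tau> rule: linorder_cases)
    case less
    have "\<bar>?ref (?a + \<tau>) - ?ref (?a + \<tau>0)\<bar> \<le> L1 * (T * v)"
      using lip[of \<tau>0 \<tau>] less \<tau>0 px(1) \<tau>v by auto
    moreover have "?s (?a + \<tau>) \<ge> \<sigma>1 + \<sigma>s * \<tau> / T" using px(3) less \<tau>0 by simp
    ultimately have "(\<sigma>s - T * L1) * v \<le> ?s (?a + \<tau>) - ?ref (?a + \<tau>)"
      using s0 ramp by (simp add: algebra_simps abs_le_iff)
    moreover have "0 \<le> v" using less T by (simp add: v_def)
    ultimately have "v * ((\<sigma>s - T * L1) * v) \<le> v * (?s (?a + \<tau>) - ?ref (?a + \<tau>))"
      by (rule mult_left_mono)
    then show ?thesis by (simp add: power2_eq_square mult.left_commute)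
  next
    case equal
    then show ?thesis by (simp add: v_def)
  next
    case greater
    have "\<bar>?ref (?a + \<tau>0) - ?ref (?a + \<tau>)\<bar> \<le> L1 * (\<tau>0 - \<tau>)"
      using lip[of \<tau> \<tau>0] greater \<tau>0(2,3) px(1) by auto
    also have "\<dots> = L1 * - (T * v)" by (simp flip: \<tau>v)
    finally have "\<bar>?ref (?a + \<tau>0) - ?ref (?a + \<tau>)\<bar> \<le> L1 * - (T * v)" .
    moreover have "?s (?a + \<tau>) \<le> \<sigma>1 + \<sigma>s * \<tau> / T" using px(2) greater \<tau>0 by simp
    ultimately have "?s (?a + \<tau>) - ?ref (?a + \<tau>) \<le> (\<sigma>s - T * L1) * v"
      using s0 ramp by (simp add: algebra_simps abs_le_iff)
    moreover have "v \<le> 0" using greater T by (simp add: v_def divide_nonpos_pos)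
    ultimately have "v * ((\<sigma>s - T * L1) * v) \<le> v * (?s (?a + \<tau>) - ?ref (?a + \<tau>))"
      by (rule mult_left_mono_neg)
    then show ?thesis by (simp add: power2_eq_square mult.left_commute)
  qed
  moreover have "((\<lambda>t. x t - x0 t) has_vector_derivative
        A *v (x t - x0 t) + (of_bool (t < ?a + \<tau>) - of_bool (t < ?a + \<tau>0)) *\<^sub>R B) (at t)"
    if "t \<in> {?a<..<?a + T} - {?a + \<tau>, ?a + \<tau>0}" for t
  proof -
    have "((\<lambda>t. x t - x0 t) has_vector_derivative
        (A *v x t + of_bool (t < ?a + \<tau>) *\<^sub>R B + q) - (A *v x0 t + of_bool (t < ?a + \<tau>0) *\<^sub>R B + q))
        (at t)"
      using that by (intro has_vector_derivative_diff pwm_solution_derivative[OF x T \<tau>]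
          pwm_solution_derivative[OF x0 T \<tau>0(1)]) auto
    also have "(A *v x t + of_bool (t < ?a + \<tau>) *\<^sub>R B + q) - (A *v x0 t + of_bool (t < ?a + \<tau>0) *\<^sub>R B + q)
        = A *v (x t - x0 t) + (of_bool (t < ?a + \<tau>) - of_bool (t < ?a + \<tau>0)) *\<^sub>R B"
      by (simp add: matrix_vector_mult_diff_distrib scaleR_left_diff_distrib)
    finally show ?thesis .
  qed
  moreover have "continuous_on {?a..?a + T} (\<lambda>t. x t - x0 t)"
    using a by (intro continuous_intros continuous_on_subset[OF cont(1)] continuous_on_subset[OF cont(2)]) auto
  ultimately show ?thesis
    using px(1) px0(1) by (simp add: mismatch_period_def v_def C)
qed

section \<open>Convergence and stability\<close>

lemma nonneg_real_in_period:
  fixes T t :: real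
  assumes "T > 0" "t \<ge> real N * T"
  obtains n where "n \<ge> N" "t \<in> {real n * T..real n * T + T}"
proof (rule that[of "nat \<lfloor>t / T\<rfloor>"])
  have "real N \<le> t / T" using assms by (simp add: field_simps)
  then have N: "int N \<le> \<lfloor>t / T\<rfloor>" by (simp add: le_floor_iff)
  then show "N \<le> nat \<lfloor>t / T\<rfloor>" by simp
  have "real (nat \<lfloor>t / T\<rfloor>) = of_int \<lfloor>t / T\<rfloor>" using N by simp
  then show "t \<in> {real (nat \<lfloor>t / T\<rfloor>) * T..real (nat \<lfloor>t / T\<rfloor>) * T + T}"
    using floor_divide_lower[OF assms(1), of t] floor_divide_upper[OF assms(1), of t]
    by (simp add: algebra_simps)
qed

theorem theorem4p1:
  fixes A :: "real ^ 'm ^ 'm" and B q C :: "real ^ 'm"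
    and \<psi> T \<sigma>1 \<sigma>s L1 \<tau>0 :: real
    and x0 :: "real \<Rightarrow> real ^ 'm"
  assumes "hurwitz_stable A"
    and "T > 0" and "\<sigma>1 > 0" and "\<sigma>s > 0"
    and "pwm_solution A B q C \<psi> T \<sigma>1 \<sigma>s x0"
    and "periodic_on_nonneg T x0"
    and "unsaturated (modulator T \<sigma>1 \<sigma>s (system_output C \<psi> x0))"
    and "\<forall>n. pulse_duration T \<sigma>1 \<sigma>s (system_output C \<psi> x0) n = \<tau>0"
    and "L1 > 0"
    and "\<forall>t\<ge>0. \<forall>d. (system_output C \<psi> x0 has_real_derivative d) (at t within {0..}) \<longrightarrow> \<bar>d\<bar> \<le> L1"
    and "\<exists>(H :: real ^ 'm ^ 'm) \<epsilon> \<nu>.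
           symmetric_matrix H \<and>
           L_matrix A B H \<prec> R_matrix A B C T \<sigma>s L1 \<epsilon> \<nu> \<and>
           positive_definite H \<and> \<nu> > 0 \<and> \<epsilon> > 0"
  shows "(\<forall>x. pwm_solution A B q C \<psi> T \<sigma>1 \<sigma>s x \<longrightarrow>
            ((\<lambda>t. x t - x0 t) \<longlongrightarrow> 0) at_top \<and>
            (\<lambda>n. pulse_duration T \<sigma>1 \<sigma>s (system_output C \<psi> x) n) \<longlonglongrightarrow> \<tau>0) \<and>
         lyapunov_stable (pwm_solution A B q C \<psi> T \<sigma>1 \<sigma>s) x0"
proof -
  note T = \<open>T > 0\<close> and x0 = assms(5) and dur = assms(8)
  obtain H :: "real ^ 'm ^ 'm" and \<epsilon> \<nu> where H: "symmetric_matrix H" "positive_definite H"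
    and lmi: "L_matrix A B H \<prec> R_matrix A B C T \<sigma>s L1 \<epsilon> \<nu>" and pos: "\<epsilon> > 0" "\<nu> > 0"
    using assms(11) by blast
  define V where "V = (\<lambda>z. z \<bullet> (H *v z))"
  have V0: "0 \<le> V z" for z
    using H(2) by (cases "z = 0") (auto simp: V_def positive_definite_def less_imp_le)
  obtain \<delta> where \<delta>: "\<delta> > 0"
    and diss: "dissipation_inequality A B C H T (\<sigma>s - T * L1) \<epsilon> \<nu> \<delta>"
    using dissipation_of_lmi[OF H(1) lmi] by blast
  obtain M where M: "M > 0"
    and est: "\<And>a \<tau> \<tau>0 \<xi> t. mismatch_period A B C (\<sigma>s - T * L1) T a \<tau> \<tau>0 \<xi> \<Longrightarrow>
        t \<in> {a..a + T} \<Longrightarrow> (norm (\<xi> t))\<^sup>2 \<le> M * (V (\<xi> a) - V (\<xi> (a + T)))"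
      "\<And>a \<tau> \<tau>0 \<xi>. mismatch_period A B C (\<sigma>s - T * L1) T a \<tau> \<tau>0 \<xi> \<Longrightarrow>
        (\<tau> - \<tau>0)\<^sup>2 \<le> M * (V (\<xi> a) - V (\<xi> (a + T)))"
    unfolding V_def using period_estimate[OF T H(1) pos \<delta> diss] by blast
  have \<tau>0: "0 < \<tau>0" "\<tau>0 < T"
    using unsaturated_pulse_duration[OF T _ dur assms(7)]
      pwm_solution_pulse_cases(1)[OF x0 T refl, of 0] dur by auto
  \<comment> \<open>\<open>D x n\<close> is the energy lost in the \<open>n\<close>-th period by the deviation of \<open>x\<close> from \<open>x0\<close>.\<close>
  define D where "D = (\<lambda>x n. V (x (real n * T) - x0 (real n * T))
      - V (x (real (Suc n) * T) - x0 (real (Suc n) * T)))"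
  have mis: "mismatch_period A B C (\<sigma>s - T * L1) T (real n * T)
      (pulse_duration T \<sigma>1 \<sigma>s (system_output C \<psi> x) n) \<tau>0 (\<lambda>t. x t - x0 t)"
    if "pwm_solution A B q C \<psi> T \<sigma>1 \<sigma>s x" for x n
    using mismatch_period_of_solutions[OF T that x0 refl _ \<tau>0 assms(10)] dur by simp
  have state: "(norm (x t - x0 t))\<^sup>2 \<le> M * D x n"
    if "pwm_solution A B q C \<psi> T \<sigma>1 \<sigma>s x" "t \<in> {real n * T..real n * T + T}" for x n t
    using est(1)[OF mis[OF that(1)] that(2)] by (simp add: D_def algebra_simps)
  have pulse: "(pulse_duration T \<sigma>1 \<sigma>s (system_output C \<psi> x) n - \<tau>0)\<^sup>2 \<le> M * D x n"
    if "pwm_solution A B q C \<psi> T \<sigma>1 \<sigma>s x" for x n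
    using est(2)[OF mis[OF that]] by (simp add: D_def algebra_simps)
  have dec: "decseq (\<lambda>n. V (x (real n * T) - x0 (real n * T)))"
    if "pwm_solution A B q C \<psi> T \<sigma>1 \<sigma>s x" for x
  proof (rule decseq_SucI)
    fix n
    have "0 \<le> M * D x n" using pulse[OF that, of n] by (rule order_trans[OF zero_le_power2])
    then show "V (x (real (Suc n) * T) - x0 (real (Suc n) * T)) \<le> V (x (real n * T) - x0 (real n * T))"
      using M by (simp add: D_def zero_le_mult_iff)
  qed

  have attract: "((\<lambda>t. x t - x0 t) \<longlongrightarrow> 0) at_top \<and>
      (\<lambda>n. pulse_duration T \<sigma>1 \<sigma>s (system_output C \<psi> x) n) \<longlonglongrightarrow> \<tau>0"
    if x: "pwm_solution A B q C \<psi> T \<sigma>1 \<sigma>s x" for x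
  proof
    obtain l where l: "(\<lambda>n. V (x (real n * T) - x0 (real n * T))) \<longlonglongrightarrow> l"
      by (rule decseq_convergent[OF dec[OF x], of 0]) (use V0 in auto)
    have "(\<lambda>n. M * D x n) \<longlonglongrightarrow> M * (l - l)" unfolding D_def
      by (intro tendsto_mult tendsto_diff tendsto_const l
          LIMSEQ_Suc[of "\<lambda>n. V (x (real n * T) - x0 (real n * T))"])
    then have MD: "(\<lambda>n. M * D x n) \<longlonglongrightarrow> 0" by simp
    show "((\<lambda>t. x t - x0 t) \<longlongrightarrow> 0) at_top"
    proof (rule tendstoI)
      fix e :: real assume "e > 0"
      then have "\<forall>\<^sub>F n in sequentially. M * D x n < e\<^sup>2"
        using MD by (intro order_tendstoD) auto
      then obtain N where N: "\<And>n. n \<ge> N \<Longrightarrow> M * D x n < e\<^sup>2"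
        by (auto simp: eventually_sequentially)
      have "norm (x t - x0 t) < e" if t: "t \<ge> real N * T" for t
      proof -
        obtain n where "n \<ge> N" "t \<in> {real n * T..real n * T + T}"
          using nonneg_real_in_period[OF T t] by blast
        then have "(norm (x t - x0 t))\<^sup>2 < e\<^sup>2" using state[OF x] N by (meson le_less_trans)
        then show ?thesis using \<open>e > 0\<close> by (simp add: power2_less_imp_less)
      qed
      then show "\<forall>\<^sub>F t in at_top. dist (x t - x0 t) 0 < e"
        unfolding eventually_at_top_linorder by (auto simp: dist_norm)
    qed
    have "(\<lambda>n. (pulse_duration T \<sigma>1 \<sigma>s (system_output C \<psi> x) n - \<tau>0)\<^sup>2) \<longlonglongrightarrow> 0"
      by (rule real_tendsto_sandwich[OF _ _ tendsto_const MD]) (use pulse[OF x] in auto)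
    from tendsto_real_sqrt[OF this]
    have "(\<lambda>n. \<bar>pulse_duration T \<sigma>1 \<sigma>s (system_output C \<psi> x) n - \<tau>0\<bar>) \<longlonglongrightarrow> 0" by simp
    then show "(\<lambda>n. pulse_duration T \<sigma>1 \<sigma>s (system_output C \<psi> x) n) \<longlonglongrightarrow> \<tau>0"
      using LIM_zero_iff tendsto_rabs_zero_iff by blast
  qed

  have "lyapunov_stable (pwm_solution A B q C \<psi> T \<sigma>1 \<sigma>s) x0"
    unfolding lyapunov_stable_def
  proof (intro allI impI)
    fix e :: real assume e: "e > 0"
    obtain \<eta> where \<eta>: "\<eta> > 0" "\<And>z. norm (H *v z) \<le> norm z * \<eta>"
      using bounded_linear.pos_bounded[OF matrix_vector_mul_bounded_linear[of H]] by blast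
    have V_le: "V z \<le> \<eta> * (norm z)\<^sup>2" for z
    proof -
      have "V z \<le> norm z * norm (H *v z)" unfolding V_def by (rule norm_cauchy_schwarz)
      also have "\<dots> \<le> norm z * (norm z * \<eta>)" using \<eta>(2) by (intro mult_left_mono) auto
      finally show ?thesis by (simp add: power2_eq_square mult_ac)
    qed
    have W: "M * \<eta> > 0" using M \<eta>(1) by simp
    show "\<exists>d>0. \<forall>x. pwm_solution A B q C \<psi> T \<sigma>1 \<sigma>s x \<and> norm (x 0 - x0 0) < d \<longrightarrow>
        (\<forall>t\<ge>0. norm (x t - x0 t) < e)"
    proof (intro exI[of _ "e / sqrt (M * \<eta>)"] conjI allI impI; (elim conjE)?)
      show "e / sqrt (M * \<eta>) > 0" using e W by simp
      fix x t assume x: "pwm_solution A B q C \<psi> T \<sigma>1 \<sigma>s x"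
        and near: "norm (x 0 - x0 0) < e / sqrt (M * \<eta>)" and t: "0 \<le> (t :: real)"
      obtain n where n: "t \<in> {real n * T..real n * T + T}"
        using nonneg_real_in_period[OF T, of 0 t] t by auto
      have "D x n \<le> V (x (real n * T) - x0 (real n * T))" using V0 by (simp add: D_def)
      also have "\<dots> \<le> V (x 0 - x0 0)" using decseqD[OF dec[OF x], of 0 n] by simp
      also have "\<dots> \<le> \<eta> * (norm (x 0 - x0 0))\<^sup>2" by (rule V_le)
      finally have "M * D x n \<le> M * (\<eta> * (norm (x 0 - x0 0))\<^sup>2)" using M by simp
      also have "\<dots> = M * \<eta> * (norm (x 0 - x0 0))\<^sup>2" by simp
      also have "\<dots> < M * \<eta> * (e / sqrt (M * \<eta>))\<^sup>2"
        using near W by (intro mult_strict_left_mono power_strict_mono) auto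
      also have "\<dots> = e\<^sup>2" using W M \<eta>(1) by (simp add: power_divide)
      finally have "(norm (x t - x0 t))\<^sup>2 < e\<^sup>2" using state[OF x n] by simp
      then show "norm (x t - x0 t) < e" using e by (simp add: power2_less_imp_less)
    qed
  qed
  with attract show ?thesis by blast
qed

end
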